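(* Let $1<p<\infty$. Let $\Omega_1$ and $\Omega_2$ be open subsets of $\mathbb{C}$ such that $\Omega_1\cap\Omega_2\neq\emptyset$. If $\operatorname{dist}(\Omega_1\setminus\Omega_2,\ \Omega_2\setminus\Omega_1)>0$, then $$A^p(\Omega_1\cap\Omega_2)\subset A^p(\Omega_1,\omega_1)+A^p(\Omega_2,\omega_1),$$ i.e. every $f\in A^p(\Omega_1\cap\Omega_2)$ can be written as $f=f_1+f_2$ on $\Omega_1\cap\Omega_2$ with $f_1\in A^p(\Omega_1,\omega_1)$ and $f_2\in A^p(\Omega_2,\omega_1)$.
   Context: For an open set $\Omega\subset\mathbb{C}$, $\operatorname{Hol}(\Omega)$ is the space of holomorphic functions on $\Omega$. For a non-negative measurable function $\omega$ on $\Omega$ and $1\le p<\infty$, the weighted Bergman space $A^p(\Omega,\omega)$ consists of all $f\in\operatorname{Hol}(\Omega)$ with $\|f\|^p_{A^p(\Omega,\omega)}:=\int_\Omega |f(x+iy)|^p\,\omega(x+iy)\,dx\,dy<+\infty$; write $A^p(\Omega)=A^p(\Omega,1)$. The weight is $\omega_1(z)=(1+|z|^{2p})^{-1}$. For sets $A,B\subset\mathbb{C}$, $\operatorname{dist}(A,B)=\inf\{|a-b|:a\in A,\ b\in B\}$. Sums of function spaces on different open sets are understood as sums of restrictions to the intersection of these open sets. *)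

theory Defs
  imports "HOL-Complex_Analysis.Complex_Analysis"
begin

text \<open>Functions on an open set \<open>\<Omega>\<close> are represented by total functions; membership in
  \<open>bergman_space p \<Omega> \<omega>\<close> depends only on the values of the function on \<open>\<Omega>\<close>.
  The weight \<open>\<omega>\<close> is meant to be non-negative and measurable on \<open>\<Omega>\<close>, and \<open>lborel\<close> on the
  complex plane is the planar Lebesgue measure \<open>dx dy\<close>.\<close>

definition bergman_space :: "real \<Rightarrow> complex set \<Rightarrow> (complex \<Rightarrow> real) \<Rightarrow> (complex \<Rightarrow> complex) set" where
  "bergman_space p \<Omega> \<omega> =
     {f. f holomorphic_on \<Omega> \<and>
         (\<integral>\<^sup>+z\<in>\<Omega>. ennreal (norm (f z) powr p * \<omega> z) \<partial>lborel) < \<infinity>}"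

definition omega1 :: "real \<Rightarrow> complex \<Rightarrow> real" where
  "omega1 p z = inverse (1 + norm z powr (2 * p))"

text \<open>Extended-real valued, so that the infimum over an empty index set is \<open>\<infinity>\<close>
  (the library constant \<open>setdist\<close> is \<open>0\<close> when one of the sets is empty).\<close>

definition esetdist :: "complex set \<Rightarrow> complex set \<Rightarrow> ereal" where
  "esetdist A B = (INF (a, b) \<in> A \<times> B. ereal (norm (a - b)))"

end

theory Submission
  imports Defs
begin

text \<open>Let \<open>W\<close> be the intersection of the two sets.  Choose a bounded cutoff \<open>\<chi>\<close> which is \<open>1\<close> near
  \<open>\<Omega>1 - \<Omega>2\<close> and \<open>0\<close> near \<open>\<Omega>2 - \<Omega>1\<close> and has bounded \<open>E = \<partial>\<chi> / \<partial>cnj z\<close> (up to a factor \<open>\<pi>\<close>), extend \<open>f\<close>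
  by zero from \<open>W\<close> to the plane, and let \<open>u\<close> be the Cauchy transform of \<open>f E\<close>.  Then
  \<open>f1 = (1 - \<chi>) f + u\<close> and \<open>f2 = \<chi> f - u\<close> are holomorphic.

  The kernel \<open>1 / (z - w)\<close> is corrected by a term which does not depend on \<open>z\<close>, which makes the transform
  converge for every function in \<open>L\<^sup>p\<close>; the weight \<open>omega1\<close> compensates the resulting growth of \<open>u\<close> by
  Hoelder's inequality and Tonelli's theorem.

  The cutoff is a mean of an indicator function over squares.  By Cauchy's formula for squares such a
  mean is itself a Cauchy transform, and locally
  \<open>\<chi>(z) f(z) - u(z)\<close> is, up to holomorphic terms, the integral of the difference quotient
  \<open>(f(z) - f(w)) / (z - w)\<close> against \<open>E(w)\<close>.  Hence neither derivatives of \<open>\<chi>\<close> nor Green's theorem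
  are needed.\<close>

subsection \<open>Integrals over the plane\<close>

text \<open>The positive distance leaves room for a transition layer of uniform width. Hence E is
  bounded and f E lies in L^p of the plane, although nothing is known about f near the boundary of
  the intersection. A point that belongs to only one of the two sets may lie on that boundary, but E
  vanishes around it, so the behaviour of f there is invisible to u.

  The weight is what Hoelder's inequality calls for. With J(z) = sqrt(1 + |z|^2) the corrected
  kernel is at most J(z) / (|z - w| J(w)). Its singularity is in L^q locally only for q < 2, so a
  factor 1 + 1/|z - w| is shifted to |G|^p, where G = f E. This yields |u(z)|^p <= C J(z)^(p-1)
  times the integral of |G(w)|^p (1 + 1/|z - w|). Multiplying by \<open>omega1\<close>, which is at
  most 2^p J(z)^(-2p), leaves the power J(z)^(-(p+1)), and p + 1 > 2 is what integrability over the
  plane requires.\<close>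

lemma nn_integral_lborel_complex_prod:
  fixes f g :: "real \<Rightarrow> ennreal"
  assumes [measurable]: "f \<in> borel_measurable borel" "g \<in> borel_measurable borel"
  shows "(\<integral>\<^sup>+z. f (Re z) * g (Im z) \<partial>lborel) = (\<integral>\<^sup>+x. f x \<partial>lborel) * (\<integral>\<^sup>+y. g y \<partial>lborel)"
proof -
  have "(\<integral>\<^sup>+z. (\<Prod>b\<in>Basis. (if b = 1 then f else g) (z \<bullet> b)) \<partial>(lborel :: complex measure))
      = (\<Prod>b\<in>(Basis::complex set). (\<integral>\<^sup>+x. (if b = 1 then f else g) x \<partial>lborel))"
    by (rule nn_integral_lborel_prod) auto
  then show ?thesis
    by (simp add: Basis_complex_def inner_complex_def complex_eq_iff)
qed

lemma lborel_distr_reflect: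
  fixes a :: "'a::euclidean_space"
  shows "distr lborel borel (\<lambda>x. a - x) = lborel"
  using lborel_affine[of "-1" a] by (simp add: density_1)

lemma nn_integral_lborel_reflect:
  fixes f :: "'a::euclidean_space \<Rightarrow> ennreal"
  assumes [measurable]: "f \<in> borel_measurable borel"
  shows "(\<integral>\<^sup>+x. f (a - x) \<partial>lborel) = (\<integral>\<^sup>+x. f x \<partial>lborel)"
  by (subst (2) lborel_distr_reflect[of a, symmetric]) (simp add: nn_integral_distr)

lemma integral_lborel_reflect:
  fixes f :: "'a::euclidean_space \<Rightarrow> 'b::{banach, second_countable_topology}"
  assumes [measurable]: "f \<in> borel_measurable borel"
  shows "(\<integral>x. f (a - x) \<partial>lborel) = (\<integral>x. f x \<partial>lborel)"
  by (subst (2) lborel_distr_reflect[of a, symmetric]) (simp add: integral_distr)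

lemma nn_integral_lborel_shift:
  fixes f :: "'a::euclidean_space \<Rightarrow> ennreal"
  assumes [measurable]: "f \<in> borel_measurable borel"
  shows "(\<integral>\<^sup>+x. f (x - a) \<partial>lborel) = (\<integral>\<^sup>+x. f x \<partial>lborel)"
  using nn_integral_lborel_reflect[of "\<lambda>x. f (- x)" a] nn_integral_lborel_reflect[of f 0] by simp

text \<open>Transfers bounds from a half-line, where antiderivatives of powers are at hand, to the
  whole line.\<close>

lemma nn_integral_even_le:
  fixes f h :: "real \<Rightarrow> ennreal"
  assumes [measurable]: "h \<in> borel_measurable borel"
    and "\<And>x. f x \<le> h x + h (- x)" and "(\<integral>\<^sup>+x. h x \<partial>lborel) < \<infinity>"
  shows "(\<integral>\<^sup>+x. f x \<partial>lborel) < \<infinity>"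
proof -
  have "(\<integral>\<^sup>+x. f x \<partial>lborel) \<le> (\<integral>\<^sup>+x. h x + h (- x) \<partial>lborel)"
    by (intro nn_integral_mono assms)
  also have "\<dots> = (\<integral>\<^sup>+x. h x \<partial>lborel) + (\<integral>\<^sup>+x. h x \<partial>lborel)"
    using nn_integral_lborel_reflect[of h 0] by (simp add: nn_integral_add)
  also have "\<dots> < \<infinity>" using assms(3) by simp
  finally show ?thesis .
qed

section \<open>Model integrals: the singularity 1/|w| and the decay at infinity\<close>

lemma nn_integral_inverse_sqrt_finite:
  "(\<integral>\<^sup>+x. ennreal (indicator {-1..1} x * \<bar>x\<bar> powr (-1/2)) \<partial>lborel) < \<infinity>"
proof (rule nn_integral_even_le)
  let ?h = "\<lambda>x::real. ennreal (x powr (-1/2)) * indicator {0..1} x"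
  show "?h \<in> borel_measurable borel" by measurable
  show "ennreal (indicator {-1..1} x * \<bar>x\<bar> powr (-1/2)) \<le> ?h x + ?h (- x)" for x
    by (auto simp: indicator_def)
  have "integral\<^sup>N lborel ?h = ennreal (1 powr (-1/2+1) / (-1/2+1))"
    by (rule nn_integral_has_integral_lebesgue'[OF _ has_integral_powr_from_0]) auto
  then show "integral\<^sup>N lborel ?h < \<infinity>" by simp
qed

lemma nn_integral_one_plus_square_powr_finite:
  fixes t :: real
  assumes "t > 1/2"
  shows "(\<integral>\<^sup>+x. ennreal ((1 + x\<^sup>2) powr (- t)) \<partial>lborel) < \<infinity>"
proof (rule nn_integral_even_le)
  let ?h = "\<lambda>x::real. indicator {0..<1} x + ennreal (x powr (- 2 * t)) * indicator {1..} x"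
  show "?h \<in> borel_measurable borel" by measurable
  have *: "(1 + x\<^sup>2) powr (- t) \<le> \<bar>x\<bar> powr (- 2 * t)" if "\<bar>x\<bar> \<ge> 1" for x :: real
  proof -
    have "(1 + x\<^sup>2) powr (- t) \<le> (x\<^sup>2) powr (- t)"
      using that assms by (intro powr_mono2') auto
    also have "\<dots> = (\<bar>x\<bar> powr 2) powr (- t)"
      using that by (simp add: powr_numeral)
    also have "\<dots> = \<bar>x\<bar> powr (- 2 * t)"
      unfolding powr_powr by simp
    finally show ?thesis .
  qed
  have **: "(1 + x\<^sup>2) powr (- t) \<le> 1" for x :: real
    using powr_mono2'[of "-t" 1 "1 + x\<^sup>2"] assms by simp
  show "ennreal ((1 + x\<^sup>2) powr (- t)) \<le> ?h x + ?h (- x)" for x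
  proof -
    consider "x \<ge> 1" | "x \<le> -1" | "0 \<le> x" "x < 1" | "x < 0" "x > -1" by linarith
    then show ?thesis
    proof cases
      case 1
      then show ?thesis using *[of x]
        by (auto simp: indicator_def intro!: add_increasing ennreal_leI)
    next
      case 2
      then show ?thesis using *[of x]
        by (auto simp: indicator_def intro!: add_increasing ennreal_leI)
    qed (use **[of x] in \<open>auto simp: indicator_def\<close>)
  qed
  have "(\<integral>\<^sup>+x. ennreal (x powr (- 2 * t)) * indicator {1..} x \<partial>lborel)
      = ennreal (- (1 powr (- 2 * t + 1)) / (- 2 * t + 1))"
    using assms by (intro nn_integral_has_integral_lebesgue'[OF _ has_integral_powr_to_inf]) auto
  then show "integral\<^sup>N lborel ?h < \<infinity>" by (subst nn_integral_add) auto
qed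

text \<open>Since |Re w| |Im w| <= |w|^2, the function 1/|w| is dominated by a product of inverse
  square roots in the two coordinates, each integrable on [-1, 1]. This replaces polar
  coordinates.\<close>

lemma nn_integral_inverse_norm_finite:
  "(\<integral>\<^sup>+w. ennreal (indicator (ball 0 1) w * inverse (norm w)) \<partial>(lborel :: complex measure)) < \<infinity>"
proof -
  let ?h = "\<lambda>x::real. ennreal (indicator {-1..1} x * \<bar>x\<bar> powr (-1/2))"
  have *: "indicator (ball 0 1) w * inverse (norm w)
      \<le> (indicator {-1..1} (Re w) * \<bar>Re w\<bar> powr (-1/2)) * (indicator {-1..1} (Im w) * \<bar>Im w\<bar> powr (-1/2))"
    if "Re w \<noteq> 0" "Im w \<noteq> 0" for w :: complex
  proof (cases "norm w < 1")
    case True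
    have "\<bar>Re w\<bar> \<le> 1" "\<bar>Im w\<bar> \<le> 1"
      using True abs_Re_le_cmod[of w] abs_Im_le_cmod[of w] by linarith+
    moreover have "inverse (norm w) \<le> inverse (sqrt (\<bar>Re w\<bar> * \<bar>Im w\<bar>))"
    proof (intro le_imp_inverse_le)
      have "\<bar>Re w\<bar> * \<bar>Im w\<bar> \<le> (Re w)\<^sup>2 + (Im w)\<^sup>2"
        using sum_squares_bound[of "\<bar>Re w\<bar>" "\<bar>Im w\<bar>"] mult_nonneg_nonneg[of "\<bar>Re w\<bar>" "\<bar>Im w\<bar>"]
        by (simp del: mult_nonneg_nonneg)
      then show "sqrt (\<bar>Re w\<bar> * \<bar>Im w\<bar>) \<le> norm w"
        unfolding cmod_def by (rule real_sqrt_le_mono)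
    qed (use that in auto)
    moreover have "inverse (sqrt (\<bar>Re w\<bar> * \<bar>Im w\<bar>)) = \<bar>Re w\<bar> powr (-1/2) * \<bar>Im w\<bar> powr (-1/2)"
      using that by (simp add: powr_minus powr_half_sqrt real_sqrt_mult)
    ultimately show ?thesis using True by (auto simp: indicator_def abs_le_iff)
  qed (auto simp: indicator_def)
  \<comment> \<open>On the axes the factor \<open>0 powr (-1/2)\<close> is 0 and the bound fails,
    but the axes form a null set.\<close>
  have AE: "AE w in lborel. Re w \<noteq> 0 \<and> Im w \<noteq> (0::real)"
    using AE_lborel_inner_neq[of "1::complex" 0] AE_lborel_inner_neq[of "\<i>" 0]
    by (auto simp: inner_complex_def Basis_complex_def)
  have "(\<integral>\<^sup>+w. ennreal (indicator (ball 0 1) w * inverse (norm w)) \<partial>(lborel :: complex measure))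
      \<le> (\<integral>\<^sup>+w. ?h (Re w) * ?h (Im w) \<partial>lborel)"
  proof (rule nn_integral_mono_AE)
    show "AE w in lborel. ennreal (indicator (ball 0 1) w * inverse (norm w)) \<le> ?h (Re w) * ?h (Im w)"
      using AE
    proof eventually_elim
      case (elim w)
      then show ?case using ennreal_leI[OF *[of w]] by (simp add: ennreal_mult)
    qed
  qed
  also have "\<dots> = (\<integral>\<^sup>+x. ?h x \<partial>lborel) * (\<integral>\<^sup>+x. ?h x \<partial>lborel)"
    by (rule nn_integral_lborel_complex_prod) auto
  also have "\<dots> < \<infinity>"
    using nn_integral_inverse_sqrt_finite by (simp add: ennreal_mult_less_top)
  finally show ?thesis .
qed

text \<open>The length of the vector (1, z), comparable to 1 + |z|. Its square is the denominator 1
  + |w|^2 of the corrected kernel.\<close>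

definition japanese_bracket :: "complex \<Rightarrow> real" where
  "japanese_bracket z = sqrt (1 + (norm z)\<^sup>2)"

lemma japanese_bracket_measurable [measurable]: "japanese_bracket \<in> borel_measurable borel"
  unfolding japanese_bracket_def by measurable

lemma japanese_bracket_ge_1: "1 \<le> japanese_bracket z"
  by (simp add: japanese_bracket_def)

lemma japanese_bracket_pos: "0 < japanese_bracket z"
  using japanese_bracket_ge_1[of z] by linarith

lemma japanese_bracket_add_le: "japanese_bracket (z + w) \<le> japanese_bracket z + norm w"
  unfolding japanese_bracket_def
proof (rule real_le_lsqrt)
  have "norm z \<le> sqrt (1 + (norm z)\<^sup>2)" by (simp add: real_le_rsqrt)
  then have "norm z * norm w \<le> sqrt (1 + (norm z)\<^sup>2) * norm w"
    by (intro mult_right_mono) auto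
  moreover have "(norm (z + w))\<^sup>2 \<le> (norm z + norm w)\<^sup>2"
    by (intro power_mono norm_triangle_ineq) auto
  ultimately show "1 + (norm (z + w))\<^sup>2 \<le> (sqrt (1 + (norm z)\<^sup>2) + norm w)\<^sup>2"
    by (simp add: power2_sum)
qed auto

text \<open>Since (1 + x^2)(1 + y^2) <= (1 + x^2 + y^2)^2, the integrand is bounded by a product of
  functions of x and of y. Each factor has exponent s/4, and s > 2 is exactly the one-dimensional
  condition s/4 > 1/2.\<close>

lemma nn_integral_japanese_bracket_finite:
  fixes s :: real
  assumes "s > 2"
  shows "(\<integral>\<^sup>+w. ennreal (japanese_bracket w powr (- s)) \<partial>lborel) < \<infinity>"
proof -
  let ?h = "\<lambda>x::real. ennreal ((1 + x\<^sup>2) powr (- (s / 4)))"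
  have *: "japanese_bracket w powr (- s) \<le> (1 + (Re w)\<^sup>2) powr (- (s / 4)) * (1 + (Im w)\<^sup>2) powr (- (s / 4))" for w
  proof -
    have "(1 + (Re w)\<^sup>2) * (1 + (Im w)\<^sup>2) \<le> (1 + (norm w)\<^sup>2)\<^sup>2"
    proof -
      have "(1 + a) * (1 + b) \<le> (1 + (a + b))\<^sup>2" if "a \<ge> 0" "b \<ge> 0" for a b :: real
        using mult_nonneg_nonneg[OF that] that by (simp add: power2_eq_square algebra_simps)
      then show ?thesis unfolding cmod_power2 by simp
    qed
    also have "1 + (norm w)\<^sup>2 = (japanese_bracket w)\<^sup>2"
      by (simp add: japanese_bracket_def)
    also have "((japanese_bracket w)\<^sup>2)\<^sup>2 = japanese_bracket w powr 4"
      using japanese_bracket_pos[of w] by (simp add: powr_numeral)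
    finally have "(1 + (Re w)\<^sup>2) * (1 + (Im w)\<^sup>2) \<le> japanese_bracket w powr 4" .
    then have "(japanese_bracket w powr 4) powr (- (s / 4)) \<le> ((1 + (Re w)\<^sup>2) * (1 + (Im w)\<^sup>2)) powr (- (s / 4))"
      using assms by (intro powr_mono2') (auto intro!: mult_pos_pos add_pos_nonneg)
    then show ?thesis
      by (simp add: powr_powr powr_mult)
  qed
  have "(\<integral>\<^sup>+w. ennreal (japanese_bracket w powr (- s)) \<partial>lborel) \<le> (\<integral>\<^sup>+w. ?h (Re w) * ?h (Im w) \<partial>lborel)"
    by (intro nn_integral_mono) (auto simp: ennreal_mult[symmetric] intro!: ennreal_leI *)
  also have "\<dots> = (\<integral>\<^sup>+x. ?h x \<partial>lborel) * (\<integral>\<^sup>+x. ?h x \<partial>lborel)"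
    by (rule nn_integral_lborel_complex_prod) auto
  also have "\<dots> < \<infinity>"
    using nn_integral_one_plus_square_powr_finite[of "s/4"] assms by (simp add: ennreal_mult_less_top)
  finally show ?thesis .
qed

text \<open>Integrating Young's inequality for \<open>t \<phi>\<close> and \<open>\<psi> / t\<close>, with \<open>t\<close> chosen such that the
  \<open>\<psi>\<close>-term is absorbed by the left-hand side.\<close>

lemma Holder_nn_integral:
  fixes p q x B :: real and \<phi> \<psi> :: "'a \<Rightarrow> real"
  assumes pq: "1 < p" "1 < q" "1 / p + 1 / q = 1"
    and [measurable]: "\<phi> \<in> borel_measurable M" "\<psi> \<in> borel_measurable M"
    and nonneg: "\<And>w. 0 \<le> \<phi> w" "\<And>w. 0 \<le> \<psi> w" "0 \<le> x" and "0 < B"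
    and B: "(\<integral>\<^sup>+w. ennreal (\<psi> w powr q) \<partial>M) \<le> ennreal B"
    and x: "ennreal x \<le> (\<integral>\<^sup>+w. ennreal (\<phi> w * \<psi> w) \<partial>M)"
  shows "ennreal (x powr p) \<le> ennreal (B powr (p - 1)) * (\<integral>\<^sup>+w. ennreal (\<phi> w powr p) \<partial>M)"
proof (cases "x = 0 \<or> (\<integral>\<^sup>+w. ennreal (\<phi> w powr p) \<partial>M) = \<infinity>")
  case True
  then show ?thesis
    using pq \<open>0 < B\<close> by (auto simp: ennreal_mult_top)
next
  case False
  then have "x > 0" using nonneg by simp
  obtain a where a: "(\<integral>\<^sup>+w. ennreal (\<phi> w powr p) \<partial>M) = ennreal a" "0 \<le> a"
    using False by (cases "\<integral>\<^sup>+w. ennreal (\<phi> w powr p) \<partial>M" rule: ennreal_cases) auto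
  define t where "t = (B / x) powr (1 / q)"
  have "t > 0" using \<open>0 < B\<close> \<open>0 < x\<close> by (simp add: t_def)
  have pq': "p * (1 / q) = p - 1"
  proof -
    have "1 / q = 1 - 1 / p" using pq by linarith
    then show ?thesis using pq by (simp only: right_diff_distrib) simp
  qed
  have tq: "t powr q = B / x" using pq \<open>0 < B\<close> \<open>0 < x\<close> by (simp add: t_def powr_powr)
  have tp: "t powr p = (B / x) powr (p - 1)"
    using pq' by (simp add: t_def powr_powr mult.commute)
  have young: "\<phi> w * \<psi> w \<le> (t powr p / p) * \<phi> w powr p + (1 / (t powr q * q)) * \<psi> w powr q" for w
    using Youngs_inequality[OF pq, of "t * \<phi> w" "\<psi> w / t"] \<open>t > 0\<close> nonneg(1,2)[of w]
    by (simp add: powr_mult powr_divide)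
  have "ennreal x \<le> (\<integral>\<^sup>+w. ennreal ((t powr p / p) * \<phi> w powr p + (1 / (t powr q * q)) * \<psi> w powr q) \<partial>M)"
    by (rule order_trans[OF x]) (intro nn_integral_mono ennreal_leI young)
  also have "\<dots> = (\<integral>\<^sup>+w. ennreal (t powr p / p) * ennreal (\<phi> w powr p)
      + ennreal (1 / (t powr q * q)) * ennreal (\<psi> w powr q) \<partial>M)"
    using pq by (intro nn_integral_cong) (simp add: ennreal_mult'[symmetric] ennreal_plus[symmetric] del: ennreal_plus)
  also have "\<dots> = ennreal (t powr p / p) * ennreal a
      + ennreal (1 / (t powr q * q)) * (\<integral>\<^sup>+w. ennreal (\<psi> w powr q) \<partial>M)"
    by (simp add: nn_integral_add nn_integral_cmult a)
  also have "\<dots> \<le> ennreal (t powr p / p) * ennreal a + ennreal (1 / (t powr q * q)) * ennreal B"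
    by (intro add_left_mono mult_left_mono B) auto
  also have "\<dots> = ennreal (t powr p / p * a + B / (t powr q * q))"
    using pq \<open>0 \<le> a\<close> \<open>0 < B\<close>
    by (simp add: ennreal_mult'[symmetric] ennreal_plus[symmetric] del: ennreal_plus)
  finally have "x \<le> t powr p / p * a + B / (t powr q * q)"
    using pq \<open>0 \<le> a\<close> \<open>0 < B\<close> by (subst (asm) ennreal_le_iff) (auto intro!: add_nonneg_nonneg)
  also have "B / (t powr q * q) = x * (1 / q)"
    using tq \<open>0 < B\<close> \<open>0 < x\<close> by simp
  also have "1 / q = 1 - 1 / p" using pq by linarith
  finally have "x \<le> t powr p * a" using pq by (simp add: field_simps)
  then have "x * x powr (p - 1) \<le> (B / x) powr (p - 1) * a * x powr (p - 1)"
    unfolding tp by (intro mult_right_mono) auto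
  also have "\<dots> = B powr (p - 1) * a"
    using \<open>0 < x\<close> \<open>0 < B\<close> by (simp add: powr_divide)
  also have "x * x powr (p - 1) = x powr p"
    using \<open>0 < x\<close> by (simp add: powr_diff)
  finally show ?thesis
    by (simp add: a(1) ennreal_mult'[symmetric] ennreal_leI)
qed

subsection \<open>The corrected Cauchy kernel\<close>

text \<open>The Cauchy kernel \<open>1 / (z - w)\<close>, corrected by the term \<open>cnj w / (1 + \<bar>w\<bar>\<^sup>2)\<close>, which does not
  depend on \<open>z\<close>, in order to gain decay in \<open>w\<close>.  At \<open>w = z\<close> its value is \<open>0\<close>.\<close>

definition cauchy_kernel :: "complex \<Rightarrow> complex \<Rightarrow> complex" where
  "cauchy_kernel z w = (1 + z * cnj w) / ((z - w) * of_real (1 + (norm w)\<^sup>2))"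

lemma cnj_measurable [measurable]: "cnj \<in> borel_measurable borel"
  by (intro borel_measurable_continuous_onI continuous_intros)

lemma cauchy_kernel_measurable [measurable (raw)]:
  assumes [measurable]: "f \<in> borel_measurable M" "g \<in> borel_measurable M"
  shows "(\<lambda>x. cauchy_kernel (f x) (g x)) \<in> borel_measurable M"
  unfolding cauchy_kernel_def by measurable

lemma one_plus_square_nonzero: "of_real (1 + (norm w)\<^sup>2) \<noteq> (0::complex)"
  by (metis add_pos_nonneg less_numeral_extra(3) of_real_eq_0_iff zero_le_power2 zero_less_one)

lemma cauchy_kernel_eq:
  assumes "z \<noteq> w"
  shows "cauchy_kernel z w = 1 / (z - w) + cnj w / of_real (1 + (norm w)\<^sup>2)"
proof -
  have "1 + z * cnj w = of_real (1 + (norm w)\<^sup>2) + cnj w * (z - w)"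
    by (simp add: complex_norm_square algebra_simps flip: of_real_power)
  then show ?thesis
    unfolding cauchy_kernel_def using assms one_plus_square_nonzero[of w] by (simp add: divide_simps mult.commute)
qed

text \<open>Cauchy-Schwarz for the vectors (1, |z|) and (1, |w|).\<close>

lemma norm_one_plus_mult_cnj_le:
  "norm (1 + z * cnj w) \<le> japanese_bracket z * japanese_bracket w"
proof -
  have "norm (1 + z * cnj w) \<le> 1 + norm z * norm w"
    by (metis complex_mod_cnj norm_mult norm_one norm_triangle_ineq)
  also have "1 + norm z * norm w \<le> japanese_bracket z * japanese_bracket w"
  proof (rule power2_le_imp_le)
    have "2 * (norm z * norm w) \<le> (norm z)\<^sup>2 + (norm w)\<^sup>2"
      using sum_squares_bound[of "norm z" "norm w"] by (simp add: algebra_simps)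
    then show "(1 + norm z * norm w)\<^sup>2 \<le> (japanese_bracket z * japanese_bracket w)\<^sup>2"
      by (simp add: japanese_bracket_def power_mult_distrib power2_sum distrib_left distrib_right)
  qed (use japanese_bracket_pos[of z] japanese_bracket_pos[of w] in simp)
  finally show ?thesis .
qed

lemma norm_of_real_one_plus_square:
  "norm (of_real (1 + (norm w)\<^sup>2) :: complex) = (japanese_bracket w)\<^sup>2"
  by (simp only: norm_of_real) (simp add: japanese_bracket_def)

text \<open>The gain over the Cauchy kernel is the factor 1/J(w), paid for by the growth J(z), with
  J the bracket. For z = w both sides are 0, because division by zero gives 0.\<close>

lemma norm_cauchy_kernel_le:
  "norm (cauchy_kernel z w) \<le> japanese_bracket z / (norm (z - w) * japanese_bracket w)"
proof -
  have "norm (cauchy_kernel z w)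
      \<le> japanese_bracket z * japanese_bracket w / (norm (z - w) * (japanese_bracket w)\<^sup>2)"
    unfolding cauchy_kernel_def norm_divide norm_mult norm_of_real_one_plus_square
    by (intro divide_right_mono norm_one_plus_mult_cnj_le) simp
  also have "\<dots> = japanese_bracket z / (norm (z - w) * japanese_bracket w)"
    using japanese_bracket_pos[of w] by (simp add: power2_eq_square field_simps)
  finally show ?thesis .
qed

text \<open>The q-th power of the kernel bound, times the factor left to it by the split of 1 + 1/r
  in Hoelder's inequality. That factor softens the singularity r^(-q), which is not integrable for q
  >= 2, to 1/r. All powers of J(z) but one are absorbed by J(z) <= 2 max(r, J(w)); the remaining one
  determines the growth of the transform.\<close>

lemma japanese_bracket_kernel_powr_le:
  fixes q :: real
  assumes q: "1 < q"
  defines "r \<equiv> \<lambda>z w. norm (z - w)"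
  defines "J \<equiv> japanese_bracket"
  shows "((J z / (r z w * J w)) powr q) * (1 + inverse (r z w)) powr (1 - q)
     \<le> 2 powr (2 * q) * J z * (indicator (ball 0 1) (z - w) * inverse (r z w)
          + J w powr (- (q + 1)) + J (z - w) powr (- (q + 1)))" (is "?L \<le> ?R")
proof (cases "r z w = 0")
  case True
  then show ?thesis
    using japanese_bracket_pos[of z] by (simp add: J_def)
next
  case False
  then have r: "r z w > 0" by (simp add: r_def)
  have Jz: "J z > 0" and Jw: "J w \<ge> 1" by (simp_all add: J_def japanese_bracket_pos japanese_bracket_ge_1)
  \<comment> \<open>The product of r and J(w) is the product a b of their minimum and maximum.
    Comparing J(z)^(q-1) with the maximum b leaves a single 1/b next to the full power of a.\<close>
  define a where "a = min (r z w) (J w)"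
  define b where "b = max (r z w) (J w)"
  have a: "a > 0" and ab: "a \<le> b" using r Jw by (auto simp: a_def b_def)
  have rJ: "r z w * J w = a * b" by (simp add: a_def b_def min_def max_def)
  have "J z \<le> J w + r z w"
    using japanese_bracket_add_le[of w "z - w"] by (simp add: J_def r_def)
  then have Jz2: "J z \<le> 2 * b" by (auto simp: b_def)
  have "(J z / (r z w * J w)) powr q = J z * J z powr (q - 1) / (a powr q * b powr q)"
    using Jz a ab by (simp add: rJ powr_divide powr_mult powr_diff)
  also have "\<dots> \<le> J z * (2 * b) powr (q - 1) / (a powr q * b powr q)"
    using Jz2 Jz q by (intro divide_right_mono mult_left_mono powr_mono2) auto
  also have "\<dots> = 2 powr (q - 1) * J z / (a powr q * b)"
    using a ab by (simp add: powr_mult powr_diff field_simps)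
  finally have k: "(J z / (r z w * J w)) powr q \<le> 2 powr (q - 1) * J z / (a powr q * b)" .
  show ?thesis
  proof (cases "r z w < 1")
    case True
    \<comment> \<open>Here r < 1 <= J(w), so a = r, and r^(-q) r^(q-1) = 1/r.\<close>
    then have "a = r z w" "b = J w" using Jw by (auto simp: a_def b_def)
    have "(1 + inverse (r z w)) powr (1 - q) \<le> (inverse (r z w)) powr (1 - q)"
      using q r by (intro powr_mono2') auto
    also have "\<dots> = r z w powr (q - 1)"
      by (simp add: inverse_eq_divide powr_divide powr_minus_divide[symmetric] powr_one_eq_one)
    finally have "?L \<le> 2 powr (q - 1) * J z / (r z w powr q * J w) * r z w powr (q - 1)"
      using k Jz Jw \<open>a = r z w\<close> \<open>b = J w\<close> by (intro mult_mono) auto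
    also have "\<dots> = 2 powr (q - 1) * J z * (inverse (r z w) / J w)"
      using r by (simp add: powr_diff field_simps)
    also have "\<dots> \<le> 2 powr (2 * q) * J z * inverse (r z w)"
      using Jz Jw r q by (intro mult_mono powr_mono) (auto simp: divide_simps)
    also have "\<dots> \<le> ?R"
      using True Jz by (intro mult_left_mono) (auto simp: r_def)
    finally show ?thesis .
  next
    case False
    have "(1 + inverse (r z w)) powr (1 - q) \<le> 1"
      using powr_mono2'[of "1 - q" 1 "1 + inverse (r z w)"] q r by simp
    then have "?L \<le> 2 powr (q - 1) * J z / (a powr q * b) * 1"
      using k Jz a ab by (intro mult_mono) auto
    \<comment> \<open>Replacing b by the smaller a gives a^(-(q+1)), at most the sum of the same
      powers of r and J(w). As r >= 1, r may be exchanged for J(z - w) up to a factor 2, and q + 1 >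
      2 makes both terms integrable in w.\<close>
    also have "\<dots> \<le> 2 powr (q - 1) * J z / (a powr q * a)"
      using Jz a ab by (simp add: frac_le)
    also have "\<dots> = 2 powr (q - 1) * J z * a powr (- (q + 1))"
    proof -
      have "a powr (- (q + 1)) = inverse (a powr q * a)"
        using a unfolding powr_minus powr_add by simp
      then show ?thesis by (simp only: divide_inverse)
    qed
    also have "\<dots> \<le> 2 powr (q - 1) * J z * (2 powr (q + 1) * (J w powr (- (q + 1)) + J (z - w) powr (- (q + 1))))"
    proof (intro mult_left_mono)
      have "J (z - w) \<le> 2 * r z w"
        unfolding J_def japanese_bracket_def
      proof (rule real_le_lsqrt)
        have "1 \<le> (r z w)\<^sup>2" using False by (simp add: not_less)
        then show "1 + (norm (z - w))\<^sup>2 \<le> (2 * r z w)\<^sup>2"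
          by (simp add: r_def power_mult_distrib)
      qed (use r in auto)
      then have "(2 * r z w) powr (- (q + 1)) \<le> J (z - w) powr (- (q + 1))"
        using q japanese_bracket_pos[of "z - w"] by (intro powr_mono2') (auto simp: J_def)
      moreover have "r z w powr (- (q + 1)) = 2 powr (q + 1) * (2 * r z w) powr (- (q + 1))"
        using r by (simp only: powr_mult) (simp add: powr_add[symmetric] del: powr_add)
      ultimately have 1: "r z w powr (- (q + 1)) \<le> 2 powr (q + 1) * J (z - w) powr (- (q + 1))"
        by simp
      have "1 * J w powr (- (q + 1)) \<le> 2 powr (q + 1) * J w powr (- (q + 1))"
        using q by (intro mult_right_mono ge_one_powr_ge_zero) auto
      with 1 show "a powr (- (q + 1)) \<le> 2 powr (q + 1) * (J w powr (- (q + 1)) + J (z - w) powr (- (q + 1)))"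
        by (auto simp: a_def min_def distrib_left intro: add_increasing add_increasing2)
    qed (use Jz in auto)
    also have "\<dots> = 2 powr (2 * q) * J z * (J w powr (- (q + 1)) + J (z - w) powr (- (q + 1)))"
      using powr_add[of 2 "q - 1" "q + 1"] by simp
    also have "\<dots> \<le> ?R"
      using Jz r by (intro mult_left_mono) auto
    finally show ?thesis .
  qed
qed

subsection \<open>Weighted estimate for the Cauchy transform\<close>

text \<open>The usual factor 1/pi is left to the density; \<open>square_mean_dbar\<close> contains
  it.\<close>

definition cauchy_transform :: "(complex \<Rightarrow> complex) \<Rightarrow> complex \<Rightarrow> complex" where
  "cauchy_transform G z = (\<integral>w. G w * cauchy_kernel z w \<partial>lborel)"

text \<open>With s = |z|^2 this rests on (1 + s)^p <= (2 max(1, s))^p <= 2^p (1 + s^p).\<close>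

lemma omega1_le:
  assumes "1 < p"
  shows "omega1 p z \<le> 2 powr p * japanese_bracket z powr (- (2 * p))"
proof -
  have "japanese_bracket z powr (2 * p) = ((japanese_bracket z)\<^sup>2) powr p"
    using japanese_bracket_pos[of z] by (simp add: powr_powr flip: powr_numeral)
  also have "\<dots> = (1 + (norm z)\<^sup>2) powr p"
    by (simp add: japanese_bracket_def)
  also have "\<dots> \<le> (2 * max 1 ((norm z)\<^sup>2)) powr p"
    using assms by (intro powr_mono2) auto
  also have "\<dots> = 2 powr p * (max 1 ((norm z)\<^sup>2)) powr p"
    by (simp add: powr_mult)
  also have "(max 1 ((norm z)\<^sup>2)) powr p \<le> 1 + norm z powr (2 * p)"
  proof -
    have "((norm z)\<^sup>2) powr p = norm z powr (2 * p)"
      by (cases "z = 0") (simp_all add: powr_powr flip: powr_numeral)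
    then show ?thesis by (simp add: max_def)
  qed
  finally have "japanese_bracket z powr (2 * p) \<le> 2 powr p * (1 + norm z powr (2 * p))"
    by simp
  then show ?thesis
    using japanese_bracket_pos[of z]
    unfolding omega1_def powr_minus by (simp add: field_simps add_pos_nonneg)
qed

text \<open>Hoelder's inequality in w, followed by Tonelli's theorem. The result is phrased with a
  measurable majorant \<open>Q\<close>, which can later be added to other integrands without asking
  whether the transform itself is measurable.\<close>

lemma cauchy_transform_weighted_Lp:
  fixes p :: real and G :: "complex \<Rightarrow> complex"
  assumes p: "1 < p" and G[measurable]: "G \<in> borel_measurable borel"
    and fin: "(\<integral>\<^sup>+w. ennreal (norm (G w) powr p) \<partial>lborel) < \<infinity>"
  shows "\<exists>Q\<in>borel_measurable borel. (\<integral>\<^sup>+z. Q z \<partial>lborel) < \<infinity>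
    \<and> (\<forall>z. ennreal (norm (cauchy_transform G z) powr p * omega1 p z) \<le> Q z)"
proof -
  define q where "q = p / (p - 1)"
  have q: "1 < q" "1 / p + 1 / q = 1" and qp: "- (1 / p) * q = 1 - q"
    using p by (auto simp: q_def field_simps)
  let ?J = japanese_bracket
  define E where "E = (\<lambda>w::complex. ennreal (indicator (ball 0 1) w * inverse (norm w)))"
  define Jq where "Jq = (\<lambda>w. ennreal (?J w powr (- (q + 1))))"
  define Jp where "Jp = (\<lambda>w. ennreal (?J w powr (- (p + 1))))"
  have [measurable]: "E \<in> borel_measurable borel"
    unfolding E_def by measurable (auto intro!: borel_measurable_inverse)
  have [measurable]: "Jq \<in> borel_measurable borel"
    unfolding Jq_def by measurable
  have [measurable]: "Jp \<in> borel_measurable borel"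
    unfolding Jp_def by measurable
  have E: "(\<integral>\<^sup>+w. E w \<partial>lborel) < \<infinity>" and Jq: "(\<integral>\<^sup>+w. Jq w \<partial>lborel) < \<infinity>" and Jp: "(\<integral>\<^sup>+w. Jp w \<partial>lborel) < \<infinity>"
    unfolding E_def Jq_def Jp_def
    by (rule nn_integral_inverse_norm_finite nn_integral_japanese_bracket_finite; use p q in simp)+
  obtain B0 where B0: "(\<integral>\<^sup>+w. E w \<partial>lborel) + (\<integral>\<^sup>+w. Jq w \<partial>lborel) + (\<integral>\<^sup>+w. Jq w \<partial>lborel) \<le> ennreal B0" "B0 > 0"
  proof -
    have "(\<integral>\<^sup>+w. E w \<partial>lborel) + (\<integral>\<^sup>+w. Jq w \<partial>lborel) + (\<integral>\<^sup>+w. Jq w \<partial>lborel) < \<infinity>"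
      using E Jq by simp
    then obtain b where "(\<integral>\<^sup>+w. E w \<partial>lborel) + (\<integral>\<^sup>+w. Jq w \<partial>lborel) + (\<integral>\<^sup>+w. Jq w \<partial>lborel) = ennreal b" "b \<ge> 0"
      by (metis ennreal_cases infinity_ennreal_def less_irrefl)
    then show ?thesis using that[of "b + 1"] by (simp add: ennreal_leI)
  qed
  define D where "D = (2 powr (2 * q) * B0) powr (p - 1) * 2 powr p"
  define Q where "Q = (\<lambda>z. ennreal D *
     (\<integral>\<^sup>+w. ennreal (norm (G w) powr p * ((1 + inverse (norm (z - w))) * ?J z powr (- (p + 1)))) \<partial>lborel))"
  have bound: "ennreal (norm (cauchy_transform G z) powr p * omega1 p z) \<le> Q z" for z
  proof -
    let ?m = "\<lambda>w. 1 + inverse (norm (z - w))"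
    \<comment> \<open>The weight 1 + 1/|z - w| is split as m^(1/p) m^(-1/p): the singularity must be
      weak enough in \<open>\<psi>\<close> for the w-integral here and in \<open>\<phi>\<close> for
      the z-integral later.\<close>
    define \<phi> where "\<phi> = (\<lambda>w. norm (G w) * ?m w powr (1 / p))"
    define \<psi> where "\<psi> = (\<lambda>w. ?J z / (norm (z - w) * ?J w) * ?m w powr (- (1 / p)))"
    have [measurable]: "\<phi> \<in> borel_measurable lborel" "\<psi> \<in> borel_measurable lborel"
      unfolding \<phi>_def \<psi>_def by measurable
    have m: "?m w > 0" for w by (simp add: add_pos_nonneg)
    have J: "?J w > 0" for w by (rule japanese_bracket_pos)
    have "(\<integral>\<^sup>+w. ennreal (\<psi> w powr q) \<partial>lborel)
        \<le> (\<integral>\<^sup>+w. ennreal (2 powr (2 * q) * ?J z) * (E (z - w) + Jq w + Jq (z - w)) \<partial>lborel)"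
    proof (rule nn_integral_mono)
      fix w
      have "\<psi> w powr q = (?J z / (norm (z - w) * ?J w)) powr q * ?m w powr (1 - q)"
        unfolding \<psi>_def powr_mult powr_powr qp ..
      also have "\<dots> \<le> 2 powr (2 * q) * ?J z * (indicator (ball 0 1) (z - w) * inverse (norm (z - w))
          + ?J w powr (- (q + 1)) + ?J (z - w) powr (- (q + 1)))"
        by (rule japanese_bracket_kernel_powr_le[OF q(1)])
      finally have "ennreal (\<psi> w powr q) \<le> ennreal \<dots>"
        by (rule ennreal_leI)
      then show "ennreal (\<psi> w powr q) \<le> ennreal (2 powr (2 * q) * ?J z) * (E (z - w) + Jq w + Jq (z - w))"
        using J[of z] by (simp add: E_def Jq_def ennreal_mult ennreal_plus)
    qed
    also have "\<dots> = ennreal (2 powr (2 * q) * ?J z) *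
        ((\<integral>\<^sup>+w. E w \<partial>lborel) + (\<integral>\<^sup>+w. Jq w \<partial>lborel) + (\<integral>\<^sup>+w. Jq w \<partial>lborel))"
      by (simp add: nn_integral_cmult nn_integral_add nn_integral_lborel_reflect)
    also have "\<dots> \<le> ennreal (2 powr (2 * q) * ?J z) * ennreal B0"
      by (intro mult_left_mono B0) auto
    also have "\<dots> = ennreal (2 powr (2 * q) * ?J z * B0)"
      using J[of z] B0 by (simp add: ennreal_mult)
    finally have psi: "(\<integral>\<^sup>+w. ennreal (\<psi> w powr q) \<partial>lborel) \<le> ennreal (2 powr (2 * q) * ?J z * B0)" .
    have "ennreal (norm (cauchy_transform G z)) \<le> (\<integral>\<^sup>+w. ennreal (norm (G w * cauchy_kernel z w)) \<partial>lborel)"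
      unfolding cauchy_transform_def
      by (metis integral_norm_bound_ennreal not_integrable_integral_eq norm_zero ennreal_0 zero_le)
    also have "\<dots> \<le> (\<integral>\<^sup>+w. ennreal (\<phi> w * \<psi> w) \<partial>lborel)"
    proof (intro nn_integral_mono ennreal_leI)
      fix w
      have "?m w powr (1 / p) * ?m w powr (- (1 / p)) = 1"
        using m[of w] by (simp flip: powr_add)
      moreover have "\<phi> w * \<psi> w = norm (G w) * (?J z / (norm (z - w) * ?J w))
          * (?m w powr (1 / p) * ?m w powr (- (1 / p)))"
        unfolding \<phi>_def \<psi>_def by (simp only: mult_ac)
      ultimately have "\<phi> w * \<psi> w = norm (G w) * (?J z / (norm (z - w) * ?J w))"
        by simp
      then show "norm (G w * cauchy_kernel z w) \<le> \<phi> w * \<psi> w"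
        using mult_left_mono[OF norm_cauchy_kernel_le[of z w], of "norm (G w)"] by (simp add: norm_mult)
    qed
    finally have u: "ennreal (norm (cauchy_transform G z)) \<le> (\<integral>\<^sup>+w. ennreal (\<phi> w * \<psi> w) \<partial>lborel)" .
    have "ennreal (norm (cauchy_transform G z) powr p)
        \<le> ennreal ((2 powr (2 * q) * ?J z * B0) powr (p - 1)) * (\<integral>\<^sup>+w. ennreal (\<phi> w powr p) \<partial>lborel)"
      by (rule Holder_nn_integral[OF p q _ _ _ _ _ _ psi u])
         (use J B0(2) in \<open>auto simp: \<phi>_def \<psi>_def less_imp_le\<close>)
    also have "(\<lambda>w. \<phi> w powr p) = (\<lambda>w. norm (G w) powr p * ?m w)"
      using p m by (auto simp: \<phi>_def powr_mult powr_powr add_nonneg_nonneg)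
    finally have "ennreal (norm (cauchy_transform G z) powr p)
        \<le> ennreal ((2 powr (2 * q) * ?J z * B0) powr (p - 1)) * (\<integral>\<^sup>+w. ennreal (norm (G w) powr p * ?m w) \<partial>lborel)"
      (is "_ \<le> ennreal ?c * ?I") .
    then have "ennreal (omega1 p z) * ennreal (norm (cauchy_transform G z) powr p)
        \<le> ennreal (2 powr p * ?J z powr (- (2 * p))) * (ennreal ?c * ?I)"
      by (intro mult_mono ennreal_leI omega1_le p) auto
    also have "\<dots> = ennreal (2 powr p * ?J z powr (- (2 * p)) * ?c) * ?I"
      by (simp add: ennreal_mult mult.assoc)
    \<comment> \<open>Hoelder's inequality contributes J(z)^(p-1) and the weight J(z)^(-2p); the
      exponents add up to -(p + 1).\<close>
    also have "2 powr p * ?J z powr (- (2 * p)) * ?c = D * ?J z powr (- (p + 1))"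
    proof -
      have "- (p + 1) = - (2 * p) + (p - 1)" by simp
      then have "?J z powr (- (p + 1)) = ?J z powr (- (2 * p)) * ?J z powr (p - 1)"
        by (simp only: powr_add)
      then show ?thesis by (simp add: D_def powr_mult)
    qed
    also have "ennreal (D * ?J z powr (- (p + 1))) * ?I = Q z"
      unfolding Q_def D_def
      by (subst ennreal_mult) (auto simp: ennreal_mult'' mult.assoc nn_integral_cmult[symmetric] ac_simps)
    finally show ?thesis
      by (simp add: omega1_def ennreal_mult[symmetric] add_nonneg_nonneg mult.commute)
  qed
  have meas: "Q \<in> borel_measurable borel"
    unfolding Q_def by measurable
  have Q: "(\<integral>\<^sup>+z. Q z \<partial>lborel) = ennreal D * (\<integral>\<^sup>+z. \<integral>\<^sup>+w.
      ennreal (norm (G w) powr p * ((1 + inverse (norm (z - w))) * ?J z powr (- (p + 1)))) \<partial>lborel \<partial>lborel)"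
    unfolding Q_def by (rule nn_integral_cmult) measurable
  have "(\<integral>\<^sup>+z. \<integral>\<^sup>+w. ennreal (norm (G w) powr p * ((1 + inverse (norm (z - w))) * ?J z powr (- (p + 1)))) \<partial>lborel \<partial>lborel)
      = (\<integral>\<^sup>+w. \<integral>\<^sup>+z. ennreal (norm (G w) powr p * ((1 + inverse (norm (z - w))) * ?J z powr (- (p + 1)))) \<partial>lborel \<partial>lborel)"
    by (rule lborel_pair.Fubini') measurable
  \<comment> \<open>After the exchange the z-integral is bounded uniformly in w: within distance 1
    of w the bracket power is at most 1 and 1/|z - w| is integrable, elsewhere 1/|z - w| is at most
    1 and the bracket power is integrable.\<close>
  also have "\<dots> \<le> (\<integral>\<^sup>+w. ennreal (norm (G w) powr p) * ((\<integral>\<^sup>+z. Jp z \<partial>lborel) + (\<integral>\<^sup>+z. Jp z \<partial>lborel) + (\<integral>\<^sup>+z. E z \<partial>lborel)) \<partial>lborel)"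
  proof (rule nn_integral_mono)
    fix w
    have "(\<integral>\<^sup>+z. ennreal (norm (G w) powr p * ((1 + inverse (norm (z - w))) * ?J z powr (- (p + 1)))) \<partial>lborel)
        \<le> (\<integral>\<^sup>+z. ennreal (norm (G w) powr p) * (Jp z + Jp z + E (z - w)) \<partial>lborel)"
    proof (rule nn_integral_mono)
      fix z
      have "?J z powr (- (p + 1)) \<le> 1"
        using powr_mono2'[of "- (p + 1)" 1 "?J z"] japanese_bracket_ge_1[of z] p by simp
      have "inverse (norm (z - w)) * ?J z powr (- (p + 1))
          \<le> ?J z powr (- (p + 1)) + indicator (ball 0 1) (z - w) * inverse (norm (z - w))"
      proof (cases "norm (z - w) < 1")
        case True
        have "inverse (norm (z - w)) * ?J z powr (- (p + 1)) \<le> inverse (norm (z - w)) * 1"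
          using \<open>?J z powr (- (p + 1)) \<le> 1\<close> by (rule mult_left_mono) simp
        then show ?thesis using True by (simp add: add_increasing)
      next
        case False
        then have "inverse (norm (z - w)) \<le> 1" by (intro inverse_le_1_iff[THEN iffD2]) auto
        then have "inverse (norm (z - w)) * ?J z powr (- (p + 1)) \<le> 1 * ?J z powr (- (p + 1))"
          by (intro mult_right_mono) auto
        then show ?thesis using False by simp
      qed
      then have "(1 + inverse (norm (z - w))) * ?J z powr (- (p + 1))
          \<le> ?J z powr (- (p + 1)) + ?J z powr (- (p + 1)) + indicator (ball 0 1) (z - w) * inverse (norm (z - w))"
        by (simp add: distrib_right)
      then have "norm (G w) powr p * ((1 + inverse (norm (z - w))) * ?J z powr (- (p + 1)))
          \<le> norm (G w) powr p * (?J z powr (- (p + 1)) + ?J z powr (- (p + 1)) + indicator (ball 0 1) (z - w) * inverse (norm (z - w)))"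
        by (rule mult_left_mono) auto
      then show "ennreal (norm (G w) powr p * ((1 + inverse (norm (z - w))) * ?J z powr (- (p + 1))))
          \<le> ennreal (norm (G w) powr p) * (Jp z + Jp z + E (z - w))"
        unfolding E_def Jp_def
        by (simp add: ennreal_plus[symmetric] ennreal_mult[symmetric] add_nonneg_nonneg ennreal_leI del: ennreal_plus)
    qed
    also have "\<dots> = ennreal (norm (G w) powr p) * ((\<integral>\<^sup>+z. Jp z \<partial>lborel) + (\<integral>\<^sup>+z. Jp z \<partial>lborel) + (\<integral>\<^sup>+z. E z \<partial>lborel))"
      by (simp add: nn_integral_cmult nn_integral_add nn_integral_lborel_shift)
    finally show "(\<integral>\<^sup>+z. ennreal (norm (G w) powr p * ((1 + inverse (norm (z - w))) * ?J z powr (- (p + 1)))) \<partial>lborel)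
        \<le> ennreal (norm (G w) powr p) * ((\<integral>\<^sup>+z. Jp z \<partial>lborel) + (\<integral>\<^sup>+z. Jp z \<partial>lborel) + (\<integral>\<^sup>+z. E z \<partial>lborel))" .
  qed
  also have "\<dots> < \<infinity>"
    using fin E Jp by (simp add: nn_integral_multc ennreal_mult_less_top)
  finally have "(\<integral>\<^sup>+z. Q z \<partial>lborel) < \<infinity>"
    unfolding Q by (simp add: ennreal_mult_less_top)
  then show ?thesis using bound meas by blast
qed

subsection \<open>Holomorphic parameter integrals\<close>

text \<open>Discs of radius r/4 around points of the half ball stay in the ball, so Cauchy's
  inequality bounds the derivative by B / (r/4); the mean value inequality does the rest.\<close>

lemma holomorphic_difference_quotient_bound:
  fixes f :: "complex \<Rightarrow> complex"
  assumes "0 < r" and holo: "f holomorphic_on ball z0 r"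
    and bound: "\<And>z. z \<in> ball z0 r \<Longrightarrow> norm (f z) \<le> B" and y: "y \<in> ball z0 (r / 2)"
  shows "norm ((f y - f z0) / (y - z0)) \<le> 4 * B / r"
proof -
  have "0 \<le> B" using bound[of z0] \<open>0 < r\<close> norm_ge_zero[of "f z0"] by (simp del: norm_ge_zero)
  have deriv: "norm (deriv f x) \<le> 4 * B / r" if x: "x \<in> ball z0 (r / 2)" for x
  proof -
    have sub: "cball x (r / 4) \<subseteq> ball z0 r"
    proof
      fix u assume "u \<in> cball x (r / 4)"
      then show "u \<in> ball z0 r"
        using x dist_triangle[of z0 u x] \<open>0 < r\<close> by (auto simp: dist_commute)
    qed
    have "norm ((deriv ^^ 1) f x) \<le> fact 1 * B / (r / 4) ^ 1"
    proof (rule Cauchy_inequality)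
      show "f holomorphic_on ball x (r / 4)"
        using holo sub ball_subset_cball holomorphic_on_subset by blast
      show "continuous_on (cball x (r / 4)) f"
        using holo sub holomorphic_on_imp_continuous_on holomorphic_on_subset by blast
      show "norm (f u) \<le> B" if "norm (x - u) = r / 4" for u
        using that sub by (intro bound) (auto simp: dist_norm subset_iff)
    qed (use \<open>0 < r\<close> in auto)
    then show ?thesis by (simp add: mult.commute)
  qed
  have "norm (f y - f z0) \<le> 4 * B / r * norm (y - z0)"
  proof (rule field_differentiable_bound[where S = "ball z0 (r / 2)" and f' = "deriv f"])
    fix x assume "x \<in> ball z0 (r / 2)"
    moreover from this have "x \<in> ball z0 r" using \<open>0 < r\<close> by auto
    ultimately show "(f has_field_derivative deriv f x) (at x within ball z0 (r / 2))"
      using holo by (meson has_field_derivative_at_within holomorphic_derivI open_ball)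
  qed (use deriv y \<open>0 < r\<close> in auto)
  then show ?thesis
    using \<open>0 \<le> B\<close> \<open>0 < r\<close> by (cases "y = z0") (auto simp: norm_divide field_simps)
qed

text \<open>Dominated convergence for difference quotients. By Cauchy's inequality a majorant
  \<open>b\<close> of the integrand already controls them, with \<open>4 * b w / r\<close>, so no
  separate bound on the derivative in z enters.\<close>

lemma field_differentiable_integral_parameter:
  fixes \<Phi> :: "complex \<Rightarrow> 'a \<Rightarrow> complex" and b :: "'a \<Rightarrow> real"
  assumes "0 < r"
    and meas: "\<And>z. z \<in> ball z0 r \<Longrightarrow> \<Phi> z \<in> borel_measurable M"
    and holo: "\<And>w. w \<in> space M \<Longrightarrow> (\<lambda>z. \<Phi> z w) holomorphic_on ball z0 r"
    and bound: "\<And>z w. z \<in> ball z0 r \<Longrightarrow> w \<in> space M \<Longrightarrow> norm (\<Phi> z w) \<le> b w"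
    and b: "integrable M b"
  shows "(\<lambda>z. \<integral>w. \<Phi> z w \<partial>M) field_differentiable at z0"
proof -
  define F where "F = (\<lambda>z. \<integral>w. \<Phi> z w \<partial>M)"
  define D where "D = (\<lambda>w. deriv (\<lambda>z. \<Phi> z w) z0)"
  have int: "integrable M (\<Phi> z)" if "z \<in> ball z0 r" for z
  proof (rule Bochner_Integration.integrable_bound[OF b meas[OF that]])
    show "AE w in M. norm (\<Phi> z w) \<le> norm (b w)"
      using bound[OF that] by (intro AE_I2) (metis abs_ge_self order_trans real_norm_def)
  qed
  have "(F has_field_derivative (\<integral>w. D w \<partial>M)) (at z0 within ball z0 (r / 2))"
    unfolding has_field_derivative_iff tendsto_at_iff_sequentially comp_def
  proof (intro allI impI)
    fix X assume X: "\<forall>i. X i \<in> ball z0 (r / 2) - {z0}" and lim: "X \<longlonglongrightarrow> z0"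
    have Xr: "X i \<in> ball z0 r" for i 
    proof -
      have "dist z0 (X i) < r / 2" using X by auto
      then show ?thesis using \<open>0 < r\<close> by auto
    qed
    have quot: "(F (X i) - F z0) / (X i - z0) = (\<integral>w. (\<Phi> (X i) w - \<Phi> z0 w) / (X i - z0) \<partial>M)" for i
      using int[OF Xr[of i]] int[of z0] \<open>0 < r\<close> by (simp add: F_def)
    have lim': "(\<lambda>i. (\<Phi> (X i) w - \<Phi> z0 w) / (X i - z0)) \<longlonglongrightarrow> D w" if "w \<in> space M" for w
    proof -
      have "((\<lambda>z. \<Phi> z w) has_field_derivative D w) (at z0)"
        unfolding D_def using holo[OF that] \<open>0 < r\<close> by (intro holomorphic_derivI) auto
      then have "((\<lambda>z. \<Phi> z w) has_field_derivative D w) (at z0 within ball z0 (r / 2))"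
        by (rule has_field_derivative_at_within)
      then show ?thesis
        unfolding has_field_derivative_iff tendsto_at_iff_sequentially comp_def using X lim by blast
    qed
    have meas': "(\<lambda>w. (\<Phi> (X i) w - \<Phi> z0 w) / (X i - z0)) \<in> borel_measurable M" for i
      using meas[OF Xr[of i]] meas[of z0] \<open>0 < r\<close> by auto
    have "(\<lambda>i. \<integral>w. (\<Phi> (X i) w - \<Phi> z0 w) / (X i - z0) \<partial>M) \<longlonglongrightarrow> (\<integral>w. D w \<partial>M)"
    proof (rule integral_dominated_convergence[where w = "\<lambda>w. 4 * b w / r"])
      show "D \<in> borel_measurable M"
        by (rule borel_measurable_LIMSEQ_metric[OF meas' lim'])
      show "AE w in M. norm ((\<Phi> (X i) w - \<Phi> z0 w) / (X i - z0)) \<le> 4 * b w / r" for i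
      proof (rule AE_I2)
        fix w assume w: "w \<in> space M"
        show "norm ((\<Phi> (X i) w - \<Phi> z0 w) / (X i - z0)) \<le> 4 * b w / r"
          using holomorphic_difference_quotient_bound[OF \<open>0 < r\<close> holo[OF w] bound[OF _ w]] X by auto
      qed
    qed (use b meas' lim' in auto)
    then show "(\<lambda>i. (F (X i) - F z0) / (X i - z0)) \<longlonglongrightarrow> (\<integral>w. D w \<partial>M)"
      by (simp only: quot)
  qed
  then have "(F has_field_derivative (\<integral>w. D w \<partial>M)) (at z0)"
    using \<open>0 < r\<close> by (simp add: at_within_open[of z0 "ball z0 (r / 2)"])
  then show ?thesis
    unfolding F_def field_differentiable_def by blast
qed

subsection \<open>Means over squares as Cauchy transforms\<close>

text \<open>The contour integral along a segment as a Lebesgue integral, so that it makes sense for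
  measurable integrands.\<close>

definition segment_integral :: "complex \<Rightarrow> complex \<Rightarrow> (complex \<Rightarrow> complex) \<Rightarrow> complex" where
  "segment_integral a b F = (b - a) * (\<integral>t. indicator {0..1} t *\<^sub>R F (linepath a b t) \<partial>lborel)"

text \<open>Counterclockwise, with the four sides in the order in which \<open>rectpath\<close> runs
  through them.\<close>

definition square_integral :: "real \<Rightarrow> (complex \<Rightarrow> complex) \<Rightarrow> complex" where
  "square_integral e F =
     segment_integral (Complex (-e) (-e)) (Complex e (-e)) F + segment_integral (Complex e (-e)) (Complex e e) F
   + segment_integral (Complex e e) (Complex (-e) e) F + segment_integral (Complex (-e) e) (Complex (-e) (-e)) F"

abbreviation square :: "real \<Rightarrow> complex set" where
  "square e \<equiv> cbox (Complex (-e) (-e)) (Complex e e)"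

lemma linepath_measurable [measurable]: "linepath a b \<in> borel_measurable borel"
  by (intro borel_measurable_continuous_onI continuous_on_linepath)

lemma segment_integral_cong:
  assumes "\<And>z. z \<in> closed_segment a b \<Longrightarrow> F z = F' z"
  shows "segment_integral a b F = segment_integral a b F'"
proof -
  have "indicator {0..1} t *\<^sub>R F (linepath a b t) = indicator {0..1} t *\<^sub>R F' (linepath a b t)" for t
    using assms linepath_in_path[of t a b] by (auto simp: indicator_def)
  then show ?thesis by (simp only: segment_integral_def)
qed

lemma segment_integral_const: "segment_integral a b (\<lambda>_. c) = (b - a) * c"
proof -
  have "(\<integral>t. indicator {0..1} t *\<^sub>R c \<partial>(lborel::real measure)) = c"
    by (subst integral_scaleR_left) auto
  then show ?thesis by (simp add: segment_integral_def)
qed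

lemma norm_segment_integral_le:
  assumes [measurable]: "F \<in> borel_measurable borel" and "\<And>z. norm (F z) \<le> B"
  shows "norm (segment_integral a b F) \<le> norm (b - a) * B"
proof -
  have le: "norm (indicator {0..1} t *\<^sub>R F (linepath a b t)) \<le> indicator {0..1} t * B" for t :: real
    using assms(2)[of "linepath a b t"] by (simp add: indicator_def)
  have B: "integrable lborel (\<lambda>t::real. indicator {0..1} t * B)" by simp
  have int: "integrable lborel (\<lambda>t. indicator {0..1} t *\<^sub>R F (linepath a b t))"
    using le by (intro Bochner_Integration.integrable_bound[OF B]) (auto intro!: AE_I2 intro: order_trans[OF _ abs_ge_self])
  have "norm (\<integral>t. indicator {0..1} t *\<^sub>R F (linepath a b t) \<partial>lborel) \<le> (\<integral>t. indicator {0..1} t * B \<partial>(lborel::real measure))"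
    by (rule Bochner_Integration.integral_norm_bound_integral[OF int B le])
  then have "norm (\<integral>t. indicator {0..1} t *\<^sub>R F (linepath a b t) \<partial>lborel) \<le> B" by simp
  then show ?thesis
    unfolding segment_integral_def norm_mult by (intro mult_left_mono) auto
qed

lemma square_integral_cong:
  assumes "\<And>z. z \<in> square e \<Longrightarrow> F z = F' z" "0 \<le> e"
  shows "square_integral e F = square_integral e F'"
proof -
  have "segment_integral a b F = segment_integral a b F'" if "a \<in> square e" "b \<in> square e" for a b
    by (rule segment_integral_cong) (use assms(1) closed_segment_subset[OF that convex_box(1)] in blast)
  then show ?thesis
    using \<open>0 \<le> e\<close> by (simp add: square_integral_def in_cbox_complex_iff)
qed

lemma square_integral_const: "square_integral e (\<lambda>_. c) = 0"
  by (simp add: square_integral_def segment_integral_const complex_eq_iff algebra_simps)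

lemma norm_square_integral_le:
  assumes "F \<in> borel_measurable borel" "\<And>z. norm (F z) \<le> B" "0 \<le> e"
  shows "norm (square_integral e F) \<le> 8 * e * B"
proof -
  have *: "norm (segment_integral a b F) \<le> 2 * e * B" if "norm (b - a) = 2 * e" for a b
    using norm_segment_integral_le[OF assms(1,2), of a b] that by simp
  have "norm (Complex e (-e) - Complex (-e) (-e)) = 2 * e" "norm (Complex e e - Complex e (-e)) = 2 * e"
     "norm (Complex (-e) e - Complex e e) = 2 * e" "norm (Complex (-e) (-e) - Complex (-e) e) = 2 * e"
    using \<open>0 \<le> e\<close> by (simp_all add: cmod_def real_sqrt_mult)
  note le = this[THEN *]
  have "norm (a + b + c + d) \<le> norm a + norm b + norm c + norm d" for a b c d :: complex
    by (intro order_trans[OF norm_triangle_ineq] add_right_mono order_refl)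
  then have "norm (square_integral e F) \<le> 2 * e * B + 2 * e * B + 2 * e * B + 2 * e * B"
    unfolding square_integral_def by (rule order_trans) (intro add_mono le)
  then show ?thesis by (simp add: mult_ac)
qed

lemma segment_integral_eq_contour_integral:
  assumes "continuous_on (closed_segment a b) F"
  shows "segment_integral a b F = contour_integral (linepath a b) F"
proof -
  have cont: "continuous_on {0..1} (\<lambda>t. F (linepath a b t))"
    by (rule continuous_on_compose2[OF assms continuous_on_linepath]) (auto simp: linepath_in_path)
  have "set_integrable lborel {0..1} (\<lambda>t. F (linepath a b t))"
    by (rule borel_integrable_compact[of "{0..1::real}", unfolded set_integrable_def[symmetric]]) (use cont in auto)
  then have "(\<integral>t. indicator {0..1} t *\<^sub>R F (linepath a b t) \<partial>lborel) = integral {0..1} (\<lambda>t. F (linepath a b t))"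
    using set_borel_integral_eq_integral(2) unfolding set_lebesgue_integral_def by blast
  then show ?thesis
    by (simp add: segment_integral_def contour_integral_integral mult.commute)
qed

text \<open>The winding number of the boundary is 1 inside and 0 outside. Points on the boundary are
  excluded; they form a null set in the averages below.\<close>

lemma square_integral_inverse:
  assumes "0 < e" "\<zeta> \<notin> square e - box (Complex (-e) (-e)) (Complex e e)"
  shows "square_integral e (\<lambda>\<eta>. 1 / (\<eta> - \<zeta>)) = 2 * of_real pi * \<i> * indicator (square e) \<zeta>"
proof -
  let ?g = "rectpath (Complex (-e) (-e)) (Complex e e)"
  have \<zeta>: "\<zeta> \<notin> path_image ?g"
    using assms by (subst path_image_rectpath_cbox_minus_box) auto
  have "winding_number ?g \<zeta> = indicator (square e) \<zeta>"
    using assms winding_number_rectpath[of \<zeta> "Complex (-e) (-e)" "Complex e e"]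
      winding_number_rectpath_outside[of "Complex (-e) (-e)" "Complex e e" \<zeta>]
    by (cases "\<zeta> \<in> square e") auto
  moreover have "winding_number ?g \<zeta> = 1 / (2 * of_real pi * \<i>) * contour_integral ?g (\<lambda>\<eta>. 1 / (\<eta> - \<zeta>))"
    using winding_number_valid_path[OF valid_path_rectpath \<zeta>] by simp
  moreover have "contour_integral ?g (\<lambda>\<eta>. 1 / (\<eta> - \<zeta>)) = square_integral e (\<lambda>\<eta>. 1 / (\<eta> - \<zeta>))"
  proof -
    let ?a1 = "Complex (-e) (-e)" and ?a2 = "Complex e (-e)" and ?a3 = "Complex e e" and ?a4 = "Complex (-e) e"
    have nin: "\<zeta> \<notin> closed_segment ?a1 ?a2" "\<zeta> \<notin> closed_segment ?a2 ?a3"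
        "\<zeta> \<notin> closed_segment ?a3 ?a4" "\<zeta> \<notin> closed_segment ?a4 ?a1"
      using \<zeta> by (auto simp: rectpath_def Let_def path_image_join)
    have cont: "continuous_on (closed_segment a b) (\<lambda>\<eta>. 1 / (\<eta> - \<zeta>))" if "\<zeta> \<notin> closed_segment a b" for a b
      using that by (auto intro!: continuous_intros)
    have ci: "(\<lambda>\<eta>. 1 / (\<eta> - \<zeta>)) contour_integrable_on linepath a b" if "\<zeta> \<notin> closed_segment a b" for a b
      by (intro contour_integrable_continuous_linepath cont that)
    note join = contour_integral_join contour_integrable_join valid_path_join valid_path_linepath
    have "contour_integral ?g (\<lambda>\<eta>. 1 / (\<eta> - \<zeta>)) =
        contour_integral (linepath ?a1 ?a2) (\<lambda>\<eta>. 1 / (\<eta> - \<zeta>)) + (contour_integral (linepath ?a2 ?a3) (\<lambda>\<eta>. 1 / (\<eta> - \<zeta>))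
        + (contour_integral (linepath ?a3 ?a4) (\<lambda>\<eta>. 1 / (\<eta> - \<zeta>)) + contour_integral (linepath ?a4 ?a1) (\<lambda>\<eta>. 1 / (\<eta> - \<zeta>))))"
      unfolding rectpath_def Let_def using nin[THEN ci]
      by (simp add: join)
    then show ?thesis
      unfolding square_integral_def by (simp only: nin[THEN cont, THEN segment_integral_eq_contour_integral] add.assoc)
  qed
  ultimately show ?thesis by (simp add: divide_eq_eq mult.commute)
qed

section \<open>Exchanging segment integrals with integrals over the plane\<close>

lemma integrable_lborel_reflect:
  fixes f :: "'a::euclidean_space \<Rightarrow> 'b::{banach, second_countable_topology}"
  assumes "integrable lborel f"
  shows "integrable lborel (\<lambda>x. f (a - x))"
proof -
  have [measurable]: "f \<in> borel_measurable borel" using assms by auto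
  show ?thesis
    using assms nn_integral_lborel_reflect[of "\<lambda>x. ennreal (norm (f x))" a]
    by (auto simp: integrable_iff_bounded)
qed

lemma integral_lborel_shift:
  fixes f :: "'a::euclidean_space \<Rightarrow> 'b::{banach, second_countable_topology}"
  assumes [measurable]: "f \<in> borel_measurable borel"
  shows "(\<integral>x. f (x - a) \<partial>lborel) = (\<integral>x. f x \<partial>lborel)"
  using integral_lborel_reflect[of "\<lambda>x. f (- x)" a] integral_lborel_reflect[of f 0] by simp

text \<open>Within distance 1 of the pole the bound \<open>M\<close> and the local integrability of
  1/|w| apply, further away the integrability of \<open>L\<close>. Uniformity in the pole matters,
  since the pole will move along a segment.\<close>

lemma nn_integral_div_norm_bounded:
  fixes L :: "complex \<Rightarrow> complex" and M :: real
  assumes [measurable]: "L \<in> borel_measurable borel" and bound: "\<And>v. norm (L v) \<le> M"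
    and int: "integrable lborel L"
  obtains C where "C < \<infinity>" "\<And>\<zeta>. (\<integral>\<^sup>+v. ennreal (norm (L v / (v - \<zeta>))) \<partial>lborel) \<le> C"
proof -
  define E where "E = (\<lambda>w::complex. ennreal (indicator (ball 0 1) w * inverse (norm w)))"
  have [measurable]: "E \<in> borel_measurable borel"
    unfolding E_def by measurable (auto intro!: borel_measurable_inverse)
  have M: "0 \<le> M" using bound[of 0] norm_ge_zero order_trans by blast
  define C where "C = ennreal M * (\<integral>\<^sup>+w. E w \<partial>lborel) + (\<integral>\<^sup>+v. ennreal (norm (L v)) \<partial>lborel)"
  show ?thesis
  proof
    show "C < \<infinity>"
      using nn_integral_inverse_norm_finite int
      by (simp add: C_def E_def ennreal_mult_less_top integrable_iff_bounded)
    fix \<zeta>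
    have "(\<integral>\<^sup>+v. ennreal (norm (L v / (v - \<zeta>))) \<partial>lborel)
        \<le> (\<integral>\<^sup>+v. ennreal M * E (v - \<zeta>) + ennreal (norm (L v)) \<partial>lborel)"
    proof (rule nn_integral_mono)
      fix v
      have "norm (L v / (v - \<zeta>)) \<le> M * (indicator (ball 0 1) (v - \<zeta>) * inverse (norm (v - \<zeta>))) + norm (L v)"
      proof (cases "norm (v - \<zeta>) < 1")
        case True
        have "norm (L v) * inverse (norm (v - \<zeta>)) \<le> M * inverse (norm (v - \<zeta>))"
          by (intro mult_right_mono bound) auto
        then show ?thesis using True by (simp add: norm_mult norm_inverse divide_inverse add_increasing2)
      next
        case False
        then have "norm (L v) / norm (v - \<zeta>) \<le> norm (L v) / 1"
          by (intro divide_left_mono) auto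
        then show ?thesis using False by (simp add: norm_divide)
      qed
      then show "ennreal (norm (L v / (v - \<zeta>))) \<le> ennreal M * E (v - \<zeta>) + ennreal (norm (L v))"
        unfolding E_def using M by (simp add: ennreal_mult[symmetric] ennreal_plus[symmetric] ennreal_leI del: ennreal_plus)
    qed
    also have "\<dots> = C"
      using nn_integral_lborel_shift[of E \<zeta>]
      by (simp add: C_def nn_integral_add nn_integral_cmult)
    finally show "(\<integral>\<^sup>+v. ennreal (norm (L v / (v - \<zeta>))) \<partial>lborel) \<le> C" .
  qed
qed

text \<open>Fubini's theorem with the substitution w = v + \<eta> in the inner integral, which moves
  the contour variable \<eta> from the kernel into the argument of \<open>L\<close>.
  \<open>H'\<close> is \<open>H\<close> after this shear.\<close>

lemma segment_integral_swap:
  fixes L :: "complex \<Rightarrow> complex" and M :: real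
  assumes L[measurable]: "L \<in> borel_measurable borel" and bound: "\<And>v. norm (L v) \<le> M"
    and int: "integrable lborel L"
  shows "integrable lborel (\<lambda>v. L v * segment_integral a b (\<lambda>\<eta>. 1 / (\<eta> - (z - v))))"
    and "integrable lborel (\<lambda>w. segment_integral a b (\<lambda>\<eta>. L (w - \<eta>)) / (w - z))"
    and "(\<integral>v. L v * segment_integral a b (\<lambda>\<eta>. 1 / (\<eta> - (z - v))) \<partial>lborel)
       = (\<integral>w. segment_integral a b (\<lambda>\<eta>. L (w - \<eta>)) / (w - z) \<partial>lborel)"
proof -
  obtain C where C: "C < \<infinity>" "\<And>\<zeta>. (\<integral>\<^sup>+v. ennreal (norm (L v / (v - \<zeta>))) \<partial>lborel) \<le> C"
    using nn_integral_div_norm_bounded[OF L bound int] by blast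
  let ?l = "linepath a b"
  define H where "H = (\<lambda>(t, v). indicator {0..1} t *\<^sub>R (L v / (v - (z - ?l t))))"
  define H' where "H' = (\<lambda>(t, w). indicator {0..1} t *\<^sub>R (L (w - ?l t) / (w - z)))"
  have [measurable]: "H \<in> borel_measurable (lborel \<Otimes>\<^sub>M lborel)" "H' \<in> borel_measurable (lborel \<Otimes>\<^sub>M lborel)"
    unfolding H_def H'_def by measurable
  have Ht: "(\<integral>\<^sup>+v. ennreal (norm (H (t, v))) \<partial>lborel) \<le> C * indicator {0..1} t" for t
    using C(2)[of "z - ?l t"] by (auto simp: H_def indicator_def)
  have H'H: "H' (t, w) = H (t, w - ?l t)" for t w
    by (simp add: H_def H'_def)
  have H't: "(\<integral>\<^sup>+w. ennreal (norm (H' (t, w))) \<partial>lborel) \<le> C * indicator {0..1} t" for t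
    using Ht[of t] nn_integral_lborel_shift[of "\<lambda>v. ennreal (norm (H (t, v)))" "?l t"] by (simp add: H'H)
  have fin: "(\<integral>\<^sup>+t. C * indicator {0..1} t \<partial>(lborel :: real measure)) < \<infinity>"
    using C(1) by (simp add: nn_integral_cmult_indicator)
  have intH: "integrable (lborel \<Otimes>\<^sub>M lborel) H"
  proof (rule integrableI_bounded)
    have "(\<integral>\<^sup>+x. ennreal (norm (H x)) \<partial>(lborel \<Otimes>\<^sub>M lborel)) = (\<integral>\<^sup>+t. \<integral>\<^sup>+v. ennreal (norm (H (t, v))) \<partial>lborel \<partial>lborel)"
      by (rule lborel.nn_integral_fst[symmetric]) measurable
    also have "\<dots> \<le> (\<integral>\<^sup>+t. C * indicator {0..1} t \<partial>(lborel :: real measure))"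
      by (intro nn_integral_mono Ht)
    finally show "(\<integral>\<^sup>+x. ennreal (norm (H x)) \<partial>(lborel \<Otimes>\<^sub>M lborel)) < \<infinity>"
      using fin by (rule order.strict_trans1)
  qed measurable
  have intH': "integrable (lborel \<Otimes>\<^sub>M lborel) H'"
  proof (rule integrableI_bounded)
    have "(\<integral>\<^sup>+x. ennreal (norm (H' x)) \<partial>(lborel \<Otimes>\<^sub>M lborel)) = (\<integral>\<^sup>+t. \<integral>\<^sup>+v. ennreal (norm (H' (t, v))) \<partial>lborel \<partial>lborel)"
      by (rule lborel.nn_integral_fst[symmetric]) measurable
    also have "\<dots> \<le> (\<integral>\<^sup>+t. C * indicator {0..1} t \<partial>(lborel :: real measure))"
      by (intro nn_integral_mono H't)
    finally show "(\<integral>\<^sup>+x. ennreal (norm (H' x)) \<partial>(lborel \<Otimes>\<^sub>M lborel)) < \<infinity>"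
      using fin by (rule order.strict_trans1)
  qed measurable
  have eqH: "L v * segment_integral a b (\<lambda>\<eta>. 1 / (\<eta> - (z - v))) = (b - a) * (\<integral>t. H (t, v) \<partial>lborel)" for v
  proof -
    have "H (t, v) = L v * (indicator {0..1} t *\<^sub>R (1 / (?l t - (z - v))))" for t
      by (simp add: H_def algebra_simps)
    then show ?thesis
      by (simp only: segment_integral_def integral_mult_right_zero mult.left_commute)
  qed
  have eqH': "segment_integral a b (\<lambda>\<eta>. L (w - \<eta>)) / (w - z) = (b - a) * (\<integral>t. H' (t, w) \<partial>lborel)" for w
  proof -
    have "H' (t, w) = (indicator {0..1} t *\<^sub>R L (w - ?l t)) / (w - z)" for t
      by (simp add: H'_def scaleR_conv_of_real)
    then show ?thesis
      by (simp only: segment_integral_def integral_divide_zero times_divide_eq_right)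
  qed
  have i1: "integrable lborel (\<lambda>v. \<integral>t. H (t, v) \<partial>lborel)"
    by (rule lborel_pair.integrable_snd) (use intH in simp)
  have i2: "integrable lborel (\<lambda>v. \<integral>t. H' (t, v) \<partial>lborel)"
    by (rule lborel_pair.integrable_snd) (use intH' in simp)
  show "integrable lborel (\<lambda>v. L v * segment_integral a b (\<lambda>\<eta>. 1 / (\<eta> - (z - v))))"
    unfolding eqH using i1 by simp
  show "integrable lborel (\<lambda>w. segment_integral a b (\<lambda>\<eta>. L (w - \<eta>)) / (w - z))"
    unfolding eqH' using i2 by simp
  have "(\<integral>v. \<integral>t. H (t, v) \<partial>lborel \<partial>lborel) = (\<integral>t. \<integral>v. H (t, v) \<partial>lborel \<partial>lborel)"
    by (rule lborel_pair.Fubini_integral) (use intH in simp)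
  also have "\<dots> = (\<integral>t. \<integral>w. H' (t, w) \<partial>lborel \<partial>lborel)"
  proof (rule Bochner_Integration.integral_cong[OF refl])
    fix t
    show "(\<integral>v. H (t, v) \<partial>lborel) = (\<integral>w. H' (t, w) \<partial>lborel)"
      using integral_lborel_shift[of "\<lambda>v. H (t, v)" "?l t"] by (simp add: H'H)
  qed
  also have "\<dots> = (\<integral>w. \<integral>t. H' (t, w) \<partial>lborel \<partial>lborel)"
    by (rule lborel_pair.Fubini_integral[symmetric]) (use intH' in simp)
  finally show "(\<integral>v. L v * segment_integral a b (\<lambda>\<eta>. 1 / (\<eta> - (z - v))) \<partial>lborel)
       = (\<integral>w. segment_integral a b (\<lambda>\<eta>. L (w - \<eta>)) / (w - z) \<partial>lborel)"
    unfolding eqH eqH' by simp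
qed

section \<open>The mean over squares and its dbar-derivative\<close>

definition square_mean :: "real \<Rightarrow> (complex \<Rightarrow> complex) \<Rightarrow> complex \<Rightarrow> complex" where
  "square_mean e L z = (\<integral>v. L v * indicator (square e) (z - v) \<partial>lborel) / of_real ((2 * e)\<^sup>2)"

text \<open>The function \<open>\<partial>(square_mean e L) / \<partial>cnj z\<close> divided by \<open>\<pi>\<close>, which by Green's theorem is a
  contour integral of \<open>L\<close> itself.\<close>

definition square_mean_dbar :: "real \<Rightarrow> (complex \<Rightarrow> complex) \<Rightarrow> complex \<Rightarrow> complex" where
  "square_mean_dbar e L w = - square_integral e (\<lambda>\<eta>. L (w - \<eta>)) / (2 * of_real pi * \<i> * of_real ((2 * e)\<^sup>2))"

lemma square_mean_dbar_measurable [measurable]: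
  assumes [measurable]: "L \<in> borel_measurable borel"
  shows "square_mean_dbar e L \<in> borel_measurable borel"
  unfolding square_mean_dbar_def square_integral_def segment_integral_def by measurable

text \<open>The perimeter 8 e against the normalisation 2 pi (2 e)^2 = 8 pi e^2. This is the
  gradient bound of the cutoff, which degenerates as e tends to 0.\<close>

lemma norm_square_mean_dbar_le:
  assumes [measurable]: "L \<in> borel_measurable borel" and "\<And>z. norm (L z) \<le> B" "0 < e"
  shows "norm (square_mean_dbar e L w) \<le> B / (pi * e)"
proof -
  have "norm (square_integral e (\<lambda>\<eta>. L (w - \<eta>))) \<le> 8 * e * B"
    using assms by (intro norm_square_integral_le) auto
  moreover have "norm (2 * of_real pi * \<i> * of_real ((2 * e)\<^sup>2) :: complex) = 2 * pi * (2 * e)\<^sup>2"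
    by (simp add: norm_mult norm_power)
  ultimately have "norm (square_mean_dbar e L w) \<le> 8 * e * B / (2 * pi * (2 * e)\<^sup>2)"
    unfolding square_mean_dbar_def norm_divide norm_minus_cancel by (simp only:) (rule divide_right_mono, auto)
  also have "\<dots> = B / (pi * e)"
    using \<open>0 < e\<close> by (simp add: field_simps power2_eq_square)
  finally show ?thesis .
qed

lemma lborel_integral_indicator_square:
  assumes "0 < e"
  shows "integrable lborel (\<lambda>v. indicator (square e) (z - v) :: real)"
    and "(\<integral>v. indicator (square e) (z - v) \<partial>lborel) = (2 * e)\<^sup>2"
proof -
  have "integrable lborel (indicator (square e) :: complex \<Rightarrow> real)"
    by (rule integrable_real_indicator[OF _ emeasure_lborel_cbox_finite]) simp
  then show "integrable lborel (\<lambda>v. indicator (square e) (z - v) :: real)"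
    by (rule integrable_lborel_reflect)
  have "(\<integral>v. indicator (square e) (z - v) \<partial>lborel) = measure lborel (square e)"
    by (subst integral_lborel_reflect) auto
  also have "\<dots> = (2 * e)\<^sup>2"
    using assms by (subst measure_lborel_cbox_eq) (auto simp: Basis_complex_def inner_complex_def complex_eq_iff power2_eq_square)
  finally show "(\<integral>v. indicator (square e) (z - v) \<partial>lborel) = (2 * e)\<^sup>2" .
qed

lemma norm_square_mean_le:
  assumes [measurable]: "L \<in> borel_measurable borel" and L: "\<And>z. norm (L z) \<le> B" and "0 < e"
  shows "norm (square_mean e L z) \<le> B"
proof -
  have le: "norm (L v * indicator (square e) (z - v)) \<le> B * indicator (square e) (z - v)" for v
    using L[of v] by (simp add: indicator_def norm_mult)
  have B: "integrable lborel (\<lambda>v. B * indicator (square e) (z - v))"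
    using lborel_integral_indicator_square(1)[OF \<open>0 < e\<close>] by simp
  have int: "integrable lborel (\<lambda>v. L v * indicator (square e) (z - v))"
    using le by (intro Bochner_Integration.integrable_bound[OF B]) (auto intro!: AE_I2 intro: order_trans[OF _ abs_ge_self])
  have "norm (\<integral>v. L v * indicator (square e) (z - v) \<partial>lborel) \<le> (\<integral>v. B * indicator (square e) (z - v) \<partial>lborel)"
    by (rule Bochner_Integration.integral_norm_bound_integral[OF int B le])
  also have "\<dots> = B * (2 * e)\<^sup>2"
    using lborel_integral_indicator_square[OF \<open>0 < e\<close>] by simp
  finally show ?thesis
    using \<open>0 < e\<close> by (simp add: square_mean_def norm_divide norm_power pos_divide_le_eq)
qed

text \<open>The crude bound |Re| + |Im| is the source of the radius \<open>2 * e\<close> in all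
  locality statements below.\<close>

lemma norm_le_of_mem_square:
  assumes "\<eta> \<in> square e" "0 < e"
  shows "norm \<eta> \<le> 2 * e"
  using assms cmod_le[of \<eta>] by (auto simp: in_cbox_complex_iff)

lemma square_mean_cong:
  assumes "\<And>v. v \<in> cball z (2 * e) \<Longrightarrow> L v = L' v" "0 < e"
  shows "square_mean e L z = square_mean e L' z"
proof -
  have "L v * indicator (square e) (z - v) = L' v * indicator (square e) (z - v)" for v
    using assms(1)[of v] norm_le_of_mem_square[OF _ assms(2), of "z - v"] by (auto simp: indicator_def dist_norm)
  then show ?thesis by (simp only: square_mean_def)
qed

lemma square_mean_dbar_cong:
  assumes "\<And>v. v \<in> cball z (2 * e) \<Longrightarrow> L v = L' v" "0 < e"
  shows "square_mean_dbar e L z = square_mean_dbar e L' z"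
proof -
  have "square_integral e (\<lambda>\<eta>. L (z - \<eta>)) = square_integral e (\<lambda>\<eta>. L' (z - \<eta>))"
    using assms norm_le_of_mem_square[OF _ assms(2)] by (intro square_integral_cong) (auto simp: dist_norm)
  then show ?thesis by (simp only: square_mean_dbar_def)
qed

lemma square_mean_const:
  assumes "0 < e"
  shows "square_mean e (\<lambda>_. c) z = c"
proof -
  have "(\<integral>v. indicator (square e) (z - v) \<partial>lborel) = (of_real ((2 * e)\<^sup>2) :: complex)"
    using integral_complex_of_real[of lborel "\<lambda>v. indicator (square e) (z - v)"] lborel_integral_indicator_square(2)[OF assms, of z]
    by (simp add: of_real_indicator)
  then show ?thesis using assms by (simp add: square_mean_def)
qed

lemma square_mean_dbar_const: "square_mean_dbar e (\<lambda>_. c) z = 0"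
  by (simp add: square_mean_dbar_def square_integral_const)

text \<open>Cauchy's formula for the indicator function of a square, averaged over the translates of the
  square: this makes the mean of \<open>L\<close> a Cauchy transform, and no derivatives of \<open>L\<close> are involved.\<close>

lemma square_mean_eq_cauchy_integral:
  fixes L :: "complex \<Rightarrow> complex" and M :: real
  assumes L[measurable]: "L \<in> borel_measurable borel" and bound: "\<And>v. norm (L v) \<le> M"
    and int: "integrable lborel L" and "0 < e"
  shows "square_mean e L z = (\<integral>w. square_mean_dbar e L w / (z - w) \<partial>lborel)"
proof -
  note swap = segment_integral_swap[OF L bound int]
  let ?c = "2 * of_real pi * \<i> :: complex"
  let ?N = "square e - box (Complex (-e) (-e)) (Complex e e)"
  have [measurable]: "?N \<in> sets borel" by simp
  have "(\<integral>\<^sup>+v. indicator ?N (z - v) \<partial>lborel) = (\<integral>\<^sup>+v. indicator ?N v \<partial>lborel)"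
    by (rule nn_integral_lborel_reflect) measurable
  also have "\<dots> = 0"
    using null_sets_cbox_Diff_box by (simp add: null_sets_def)
  finally have "AE v in lborel. indicator ?N (z - v) = (0::ennreal)"
    by (subst (asm) nn_integral_0_iff_AE) auto
  then have "(\<integral>v. L v * square_integral e (\<lambda>\<eta>. 1 / (\<eta> - (z - v))) \<partial>lborel)
      = (\<integral>v. ?c * (L v * indicator (square e) (z - v)) \<partial>lborel)"
  proof (intro integral_cong_AE)
    show "(\<lambda>v. L v * square_integral e (\<lambda>\<eta>. 1 / (\<eta> - (z - v)))) \<in> borel_measurable lborel"
      unfolding square_integral_def distrib_left using swap(1)[THEN borel_measurable_integrable]
      by (intro borel_measurable_add)
    assume "AE v in lborel. indicator ?N (z - v) = (0::ennreal)"
    then show "AE v in lborel. L v * square_integral e (\<lambda>\<eta>. 1 / (\<eta> - (z - v))) = ?c * (L v * indicator (square e) (z - v))"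
    proof eventually_elim
      case (elim v)
      then have "z - v \<notin> ?N" by (metis indicator_simps(1) zero_neq_one)
      then show ?case by (simp add: square_integral_inverse[OF \<open>0 < e\<close>])
    qed
  qed measurable
  also have "\<dots> = ?c * (\<integral>v. L v * indicator (square e) (z - v) \<partial>lborel)"
    by (rule integral_mult_right_zero)
  also have "(\<integral>v. L v * square_integral e (\<lambda>\<eta>. 1 / (\<eta> - (z - v))) \<partial>lborel)
      = (\<integral>w. square_integral e (\<lambda>\<eta>. L (w - \<eta>)) / (w - z) \<partial>lborel)"
    unfolding square_integral_def distrib_left add_divide_distrib
    by (simp only: Bochner_Integration.integral_add swap Bochner_Integration.integrable_add)
  finally have "?c * (\<integral>v. L v * indicator (square e) (z - v) \<partial>lborel)
      = (\<integral>w. square_integral e (\<lambda>\<eta>. L (w - \<eta>)) / (w - z) \<partial>lborel)" ..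
  then have "(\<integral>v. L v * indicator (square e) (z - v) \<partial>lborel)
      = (\<integral>w. square_integral e (\<lambda>\<eta>. L (w - \<eta>)) / (w - z) \<partial>lborel) / ?c"
    by (simp add: field_simps)
  then have "square_mean e L z
      = (\<integral>w. square_integral e (\<lambda>\<eta>. L (w - \<eta>)) / (w - z) / ?c / of_real ((2 * e)\<^sup>2) \<partial>lborel)"
    unfolding square_mean_def by (simp only: integral_divide_zero)
  also have "(\<lambda>w. square_integral e (\<lambda>\<eta>. L (w - \<eta>)) / (w - z) / ?c / of_real ((2 * e)\<^sup>2))
      = (\<lambda>w. square_mean_dbar e L w / (z - w))"
  proof
    fix w
    have "z - w = - (w - z)" by simp
    then show "square_integral e (\<lambda>\<eta>. L (w - \<eta>)) / (w - z) / ?c / of_real ((2 * e)\<^sup>2) = square_mean_dbar e L w / (z - w)"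
      unfolding square_mean_dbar_def by (simp only: divide_minus_right minus_divide_left minus_minus divide_divide_eq_left mult_ac)
  qed
  finally show ?thesis .
qed

subsection \<open>Local behaviour of the Cauchy transform\<close>

text \<open>Away from the support of \<open>G\<close> the corrected kernel is of order J(w)^(-2),
  uniformly in z. Young's inequality then gives the majorant |G|^p / p + J^(-2q) / q, integrable
  because 2 q > 2. The uncorrected kernel would give J^(-q), which is integrable only for p <
  2.\<close>

lemma cauchy_kernel_dominated:
  fixes G :: "complex \<Rightarrow> complex" and p r :: real
  assumes p: "1 < p" and [measurable]: "G \<in> borel_measurable borel"
    and fin: "(\<integral>\<^sup>+w. ennreal (norm (G w) powr p) \<partial>lborel) < \<infinity>"
    and far: "\<And>w. w \<in> ball z0 r \<Longrightarrow> G w = 0" and "0 < r"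
  obtains b where "integrable lborel b"
    "\<And>z w. z \<in> ball z0 (r / 2) \<Longrightarrow> norm (G w * cauchy_kernel z w) \<le> b w"
proof -
  let ?J = japanese_bracket
  define q where "q = p / (p - 1)"
  have q: "1 < q" "1 / p + 1 / q = 1" using p by (auto simp: q_def field_simps)
  \<comment> \<open>\<open>A\<close> bounds J(z) on the half ball. As |z - w| >= r/2, J(w) <= A + |z
    - w| <= (2 A / r + 1) |z - w|; \<open>C\<close> is the product of both constants.\<close>
  define A where "A = ?J z0 + r"
  define C where "C = A * (2 * A / r + 1)"
  define b where "b = (\<lambda>w. C * (norm (G w) powr p / p + ?J w powr (- (2 * q)) / q))"
  have A: "A > 0" using japanese_bracket_pos[of z0] \<open>0 < r\<close> by (simp add: A_def)
  then have C: "C > 0" using \<open>0 < r\<close> by (auto simp: C_def intro!: mult_pos_pos add_pos_pos)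
  show ?thesis
  proof
    have "integrable lborel (\<lambda>w. norm (G w) powr p)"
      using fin by (intro integrableI_bounded) auto
    moreover have "integrable lborel (\<lambda>w. ?J w powr (- (2 * q)))"
      using nn_integral_japanese_bracket_finite[of "2 * q"] q by (intro integrableI_bounded) auto
    ultimately show "integrable lborel b" unfolding b_def by simp
    fix z w assume z: "z \<in> ball z0 (r / 2)"
    show "norm (G w * cauchy_kernel z w) \<le> b w"
    proof (cases "w \<in> ball z0 r")
      case True
      have "0 \<le> b w" unfolding b_def using C p q by (intro mult_nonneg_nonneg add_nonneg_nonneg) auto
      then show ?thesis by (simp add: far[OF True])
    next
      case False
      have Jw: "?J w > 0" by (rule japanese_bracket_pos)
      have "dist z0 z < r / 2" "r \<le> dist z0 w" using z False by auto
      then have zw: "norm (z - w) \<ge> r / 2" and zz: "norm (z - z0) \<le> r"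
        using dist_triangle[of z0 w z] \<open>0 < r\<close> by (auto simp: dist_norm norm_minus_commute)
      have Jz: "?J z \<le> A"
        using japanese_bracket_add_le[of z0 "z - z0"] zz by (simp add: A_def)
      have "?J w \<le> ?J z + norm (w - z)"
        using japanese_bracket_add_le[of z "w - z"] by simp
      also have "\<dots> \<le> A + norm (z - w)" using Jz by (simp add: norm_minus_commute)
      also have "A \<le> (2 * A / r) * norm (z - w)"
        using mult_left_mono[OF zw, of "2 * A / r"] A \<open>0 < r\<close> by simp
      finally have "?J w \<le> (2 * A / r + 1) * norm (z - w)" by (simp add: distrib_right)
      then have k: "1 / norm (z - w) \<le> (2 * A / r + 1) / ?J w"
      proof -
        have n: "norm (z - w) > 0" using zw \<open>0 < r\<close> by linarith
        show ?thesis
          using \<open>?J w \<le> (2 * A / r + 1) * norm (z - w)\<close>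
          by (simp add: pos_le_divide_eq[OF Jw] pos_divide_le_eq[OF n])
      qed
      have "norm (cauchy_kernel z w) \<le> ?J z * (1 / norm (z - w)) / ?J w"
        using norm_cauchy_kernel_le[of z w] by simp
      also have "\<dots> \<le> A * ((2 * A / r + 1) / ?J w) / ?J w"
        using k Jz Jw A japanese_bracket_pos[of z] by (intro divide_right_mono mult_mono) auto
      also have "\<dots> = C * ?J w powr (- 2)"
        using Jw by (simp add: C_def powr_minus powr_numeral power2_eq_square field_simps)
      finally have "norm (G w * cauchy_kernel z w) \<le> norm (G w) * (C * ?J w powr (- 2))"
        unfolding norm_mult by (intro mult_left_mono) auto
      also have "\<dots> = C * (norm (G w) * ?J w powr (- 2))" by simp
      also have "\<dots> \<le> C * (norm (G w) powr p / p + (?J w powr (- 2)) powr q / q)"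
        using C by (intro mult_left_mono Youngs_inequality[OF p q]) auto
      also have "\<dots> = b w" by (simp add: b_def powr_powr)
      finally show ?thesis .
    qed
  qed
qed

lemma cauchy_transform_field_differentiable_far:
  fixes G :: "complex \<Rightarrow> complex" and p r :: real
  assumes p: "1 < p" and G[measurable]: "G \<in> borel_measurable borel"
    and fin: "(\<integral>\<^sup>+w. ennreal (norm (G w) powr p) \<partial>lborel) < \<infinity>"
    and far: "\<And>w. w \<in> ball z0 r \<Longrightarrow> G w = 0" and "0 < r"
  shows "cauchy_transform G field_differentiable at z0"
proof -
  obtain b where b: "integrable lborel b"
      "\<And>z w. z \<in> ball z0 (r / 2) \<Longrightarrow> norm (G w * cauchy_kernel z w) \<le> b w"
    using cauchy_kernel_dominated[OF p G fin far \<open>0 < r\<close>] by blast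
  have "(\<lambda>z. \<integral>w. G w * cauchy_kernel z w \<partial>lborel) field_differentiable at z0"
  proof (rule field_differentiable_integral_parameter[where r = "r / 2" and b = b])
    show "(\<lambda>z. G w * cauchy_kernel z w) holomorphic_on ball z0 (r / 2)" for w
    proof (cases "w \<in> ball z0 r")
      case False
      then have "z - w \<noteq> 0" if "z \<in> ball z0 (r / 2)" for z
        using that \<open>0 < r\<close> by auto
      then show ?thesis
        unfolding cauchy_kernel_def using one_plus_square_nonzero[of w]
        by (intro holomorphic_intros) auto
    qed (simp add: far)
  qed (use b \<open>0 < r\<close> in auto)
  then show ?thesis
    unfolding cauchy_transform_def[abs_def] .
qed

text \<open>As |w| / (1 + |w|^2) <= 1, the correction is integrable against \<open>H\<close> by
  itself. The transform is then the classical one plus a constant, which is harmless for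
  holomorphy.\<close>

lemma cauchy_transform_bounded_integrable:
  fixes H :: "complex \<Rightarrow> complex"
  assumes H[measurable]: "H \<in> borel_measurable borel" and bound: "\<And>w. norm (H w) \<le> M"
    and int: "integrable lborel H"
  shows "integrable lborel (\<lambda>w. H w * cauchy_kernel z w)"
    and "cauchy_transform H z = (\<integral>w. H w / (z - w) \<partial>lborel)
           + (\<integral>w. H w * (cnj w / of_real (1 + (norm w)\<^sup>2)) \<partial>(lborel :: complex measure))"
proof -
  obtain C where C: "C < \<infinity>" "\<And>\<zeta>. (\<integral>\<^sup>+v. ennreal (norm (H v / (v - \<zeta>))) \<partial>lborel) \<le> C"
    using nn_integral_div_norm_bounded[OF H bound int] by blast
  have i1: "integrable lborel (\<lambda>w. H w / (z - w))"
  proof (rule integrableI_bounded)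
    have "(\<integral>\<^sup>+w. ennreal (norm (H w / (z - w))) \<partial>lborel) = (\<integral>\<^sup>+w. ennreal (norm (H w / (w - z))) \<partial>lborel)"
      by (simp add: norm_divide norm_minus_commute)
    then show "(\<integral>\<^sup>+w. ennreal (norm (H w / (z - w))) \<partial>lborel) < \<infinity>"
      using C(2)[of z] C(1) by (simp add: order.strict_trans1)
  qed measurable
  have i2: "integrable lborel (\<lambda>w. H w * (cnj w / of_real (1 + (norm w)\<^sup>2)))"
  proof (rule Bochner_Integration.integrable_bound[OF int])
    show "AE w in lborel. norm (H w * (cnj w / of_real (1 + (norm w)\<^sup>2))) \<le> norm (H w)"
    proof (rule AE_I2)
      fix w :: complex
      have "norm w \<le> 1 + (norm w)\<^sup>2"
        using sum_squares_bound[of "norm w" 1] norm_ge_zero[of w] by (simp del: norm_ge_zero)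
      moreover have "norm (of_real (1 + (norm w)\<^sup>2) :: complex) = 1 + (norm w)\<^sup>2"
        by (simp only: norm_of_real) simp
      ultimately have "norm (cnj w / of_real (1 + (norm w)\<^sup>2)) \<le> 1"
        by (simp only: norm_divide complex_mod_cnj) (simp add: divide_le_eq add_pos_nonneg)
      then show "norm (H w * (cnj w / of_real (1 + (norm w)\<^sup>2))) \<le> norm (H w)"
        unfolding norm_mult by (intro mult_left_le) auto
    qed
  qed measurable
  have AE: "AE w in lborel. H w * cauchy_kernel z w = H w / (z - w) + H w * (cnj w / of_real (1 + (norm w)\<^sup>2))"
    using AE_lborel_singleton[of z]
  proof eventually_elim
    case (elim w)
    then show ?case by (subst cauchy_kernel_eq) (auto simp: distrib_left)
  qed
  have i3: "integrable lborel (\<lambda>w. H w / (z - w) + H w * (cnj w / of_real (1 + (norm w)\<^sup>2)))"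
    by (intro Bochner_Integration.integrable_add i1 i2)
  show "integrable lborel (\<lambda>w. H w * cauchy_kernel z w)"
    by (rule integrable_cong_AE_imp[OF i3]) (use AE in \<open>auto simp: eq_commute\<close>)
  have "cauchy_transform H z = (\<integral>w. H w / (z - w) + H w * (cnj w / of_real (1 + (norm w)\<^sup>2)) \<partial>lborel)"
    unfolding cauchy_transform_def by (intro integral_cong_AE AE) measurable
  then show "cauchy_transform H z = (\<integral>w. H w / (z - w) \<partial>lborel)
           + (\<integral>w. H w * (cnj w / of_real (1 + (norm w)\<^sup>2)) \<partial>(lborel :: complex measure))"
    using Bochner_Integration.integral_add[OF i1 i2] by simp
qed

lemma integrable_bounded_ball:
  fixes H :: "'a::euclidean_space \<Rightarrow> 'b::{banach, second_countable_topology}"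
  assumes [measurable]: "H \<in> borel_measurable borel" and bound: "\<And>w. norm (H w) \<le> M"
    and supp: "\<And>w. w \<notin> ball c R \<Longrightarrow> H w = 0"
  shows "integrable lborel H"
proof (rule Bochner_Integration.integrable_bound)
  show "integrable lborel (\<lambda>w. M * indicator (ball c R) w)"
    by (intro integrable_mult_right integrable_real_indicator[OF _ emeasure_lborel_ball_finite]) simp
  show "AE w in lborel. norm (H w) \<le> norm (M * indicator (ball c R) w)"
    using bound supp by (intro AE_I2) (auto simp: indicator_def intro: order_trans[OF _ abs_ge_self])
qed simp

lemma nn_integral_powr_bounded_ball:
  fixes H :: "complex \<Rightarrow> complex"
  assumes [measurable]: "H \<in> borel_measurable borel" and bound: "\<And>w. norm (H w) \<le> M"
    and supp: "\<And>w. w \<notin> ball c R \<Longrightarrow> H w = 0" and "1 < p"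
  shows "(\<integral>\<^sup>+w. ennreal (norm (H w) powr p) \<partial>lborel) < \<infinity>"
proof -
  have "integrable lborel (\<lambda>w. norm (H w) powr p)"
  proof (rule integrable_bounded_ball)
    show "norm (norm (H w) powr p) \<le> M powr p" for w
      using bound[of w] \<open>1 < p\<close> by (auto intro: powr_mono2)
  qed (use supp in auto)
  then show ?thesis by (simp add: integrable_iff_bounded)
qed

text \<open>Reduces differentiability at z0 to a bounded density supported in a ball. Both integrals
  exist, as additivity demands: the near density is bounded and integrable, and the far one vanishes
  around z0 and is dominated.\<close>

lemma cauchy_transform_split:
  fixes G :: "complex \<Rightarrow> complex" and p r M :: real
  assumes p: "1 < p" and G[measurable]: "G \<in> borel_measurable borel"
    and fin: "(\<integral>\<^sup>+w. ennreal (norm (G w) powr p) \<partial>lborel) < \<infinity>" and "0 < r"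
    and bound: "\<And>w. w \<in> ball z0 r \<Longrightarrow> norm (G w) \<le> M"
  defines "G' \<equiv> \<lambda>w. indicator (ball z0 r) w * G w" and "G'' \<equiv> \<lambda>w. indicator (- ball z0 r) w * G w"
  shows "\<And>z. z \<in> ball z0 (r / 2) \<Longrightarrow> cauchy_transform G z = cauchy_transform G' z + cauchy_transform G'' z"
    and "cauchy_transform G'' field_differentiable at z0"
proof -
  have [measurable]: "G' \<in> borel_measurable borel"
    unfolding G'_def by (intro borel_measurable_times borel_measurable_indicator G) auto
  have [measurable]: "G'' \<in> borel_measurable borel"
    unfolding G''_def by (intro borel_measurable_times borel_measurable_indicator G) auto
  have far: "G'' w = 0" if "w \<in> ball z0 r" for w using that by (simp add: G''_def)
  have fin'': "(\<integral>\<^sup>+w. ennreal (norm (G'' w) powr p) \<partial>lborel) < \<infinity>"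
    by (rule order.strict_trans1[OF nn_integral_mono fin]) (auto simp: G''_def indicator_def)
  show "cauchy_transform G'' field_differentiable at z0"
    by (rule cauchy_transform_field_differentiable_far[OF p _ fin'' far \<open>0 < r\<close>]) measurable
  fix z assume z: "z \<in> ball z0 (r / 2)"
  have M: "0 \<le> M" using bound[of z0] \<open>0 < r\<close> norm_ge_zero order_trans by (metis centre_in_ball)
  have b': "norm (G' w) \<le> M" for w using bound[of w] M by (auto simp: G'_def indicator_def)
  have "integrable lborel G'"
    by (rule integrable_bounded_ball[OF \<open>G' \<in> borel_measurable borel\<close> b', where c = z0 and R = r]) (auto simp: G'_def)
  then have i': "integrable lborel (\<lambda>w. G' w * cauchy_kernel z w)"
    by (intro cauchy_transform_bounded_integrable(1)[OF _ b']) auto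
  obtain b where intb: "integrable lborel b"
      and b: "\<And>z w. z \<in> ball z0 (r / 2) \<Longrightarrow> norm (G'' w * cauchy_kernel z w) \<le> b w"
    using cauchy_kernel_dominated[OF p \<open>G'' \<in> borel_measurable borel\<close> fin'' far \<open>0 < r\<close>] by blast
  have i'': "integrable lborel (\<lambda>w. G'' w * cauchy_kernel z w)"
  proof (rule Bochner_Integration.integrable_bound[OF intb])
    show "AE w in lborel. norm (G'' w * cauchy_kernel z w) \<le> norm (b w)"
      using b[OF z] by (intro AE_I2) (metis abs_ge_self order_trans real_norm_def)
  qed measurable
  have "G w * cauchy_kernel z w = G' w * cauchy_kernel z w + G'' w * cauchy_kernel z w" for w
    by (simp add: G'_def G''_def indicator_def)
  then show "cauchy_transform G z = cauchy_transform G' z + cauchy_transform G'' z"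
    unfolding cauchy_transform_def by (simp add: Bochner_Integration.integral_add[OF i' i''])
qed

section \<open>Holomorphy on the intersection\<close>

text \<open>In the commutator of multiplication by f with the transform, the kernel is multiplied by
  f(z) - f(w), which cancels its pole. The resulting integrand is holomorphic in z and bounded on
  the ball, so the parameter integral is differentiable for a merely bounded measurable
  \<open>E\<close>.\<close>

lemma cauchy_transform_commutator_field_differentiable:
  fixes f f0 E :: "complex \<Rightarrow> complex" and r B :: real
  assumes f: "f holomorphic_on W" and "open W" and W: "cball z0 r \<subseteq> W" and "0 < r"
    and f0[measurable]: "f0 \<in> borel_measurable borel" and f0_eq: "\<And>w. w \<in> W \<Longrightarrow> f0 w = f w"
    and E[measurable]: "E \<in> borel_measurable borel" and B: "\<And>w. norm (E w) \<le> B"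
  shows "(\<lambda>z. f z * cauchy_transform (\<lambda>w. indicator (ball z0 r) w * E w) z
            - cauchy_transform (\<lambda>w. indicator (ball z0 r) w * (f0 w * E w)) z) field_differentiable at z0"
proof -
  let ?V = "ball z0 r"
  have VW: "w \<in> W" if "w \<in> ?V" for w using that W by (auto simp: subset_iff)
  define E' where "E' = (\<lambda>w. indicator ?V w * E w)"
  define G' where "G' = (\<lambda>w. indicator ?V w * (f0 w * E w))"
  have V[measurable]: "?V \<in> sets borel" by simp
  have E'[measurable]: "E' \<in> borel_measurable borel" unfolding E'_def by measurable
  have G'[measurable]: "G' \<in> borel_measurable borel" unfolding G'_def by measurable
  have B0: "0 \<le> B" using B[of 0] norm_ge_zero order_trans by blast
  have "compact (f ` cball z0 r)" "compact (deriv f ` cball z0 r)"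
    using W f holomorphic_deriv[OF f \<open>open W\<close>]
    by (auto intro!: compact_continuous_image intro: holomorphic_on_imp_continuous_on holomorphic_on_subset)
  then obtain Mf M1 where Mf: "\<And>z. z \<in> cball z0 r \<Longrightarrow> norm (f z) \<le> Mf"
      and M1: "\<And>z. z \<in> cball z0 r \<Longrightarrow> norm (deriv f z) \<le> M1"
    by (metis bounded_iff compact_imp_bounded imageI)
  have "0 \<le> Mf" "0 \<le> M1"
    using Mf[of z0] M1[of z0] \<open>0 < r\<close> norm_ge_zero order_trans by (metis centre_in_cball less_imp_le)+
  have bE': "norm (E' w) \<le> B" for w using B[of w] B0 by (auto simp: E'_def indicator_def)
  have bG': "norm (G' w) \<le> Mf * B" for w
  proof (cases "w \<in> ?V")
    case True
    then have "f0 w = f w" "w \<in> cball z0 r" using f0_eq[OF VW] by auto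
    then show ?thesis using True Mf B \<open>0 \<le> Mf\<close> by (auto simp: G'_def norm_mult intro!: mult_mono)
  next
    case False
    then show ?thesis using \<open>0 \<le> Mf\<close> B0 by (simp add: G'_def)
  qed
  have "integrable lborel E'" by (rule integrable_bounded_ball[OF E' bE', where c = z0 and R = r]) (simp add: E'_def)
  note iE' = cauchy_transform_bounded_integrable(1)[OF E' bE' this]
  have "integrable lborel G'" by (rule integrable_bounded_ball[OF G' bG', where c = z0 and R = r]) (simp add: G'_def)
  note iG' = cauchy_transform_bounded_integrable(1)[OF G' bG' this]
  \<comment> \<open>The diagonal value makes the singularity at z = w removable, so that
    \<open>S\<close> is holomorphic in z; the derivative bound \<open>M1\<close> bounds it.\<close>
  define S where "S = (\<lambda>z w. if z = w then deriv f z else (f z - f0 w) / (z - w))"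
  define \<Phi> where "\<Phi> = (\<lambda>z w. E' w * (S z w * ((1 + z * cnj w) / of_real (1 + (norm w)\<^sup>2))))"
  have eq: "f z * cauchy_transform E' z - cauchy_transform G' z = (\<integral>w. \<Phi> z w \<partial>lborel)" for z
  proof -
    have "f z * cauchy_transform E' z - cauchy_transform G' z
        = (\<integral>w. f z * (E' w * cauchy_kernel z w) - G' w * cauchy_kernel z w \<partial>lborel)"
      unfolding cauchy_transform_def using iE'[of z] iG'[of z] by simp
    also have "\<dots> = (\<integral>w. \<Phi> z w \<partial>lborel)"
    proof (rule integral_cong_AE)
      show "AE w in lborel. f z * (E' w * cauchy_kernel z w) - G' w * cauchy_kernel z w = \<Phi> z w"
        using AE_lborel_singleton[of z]
      proof eventually_elim
        case (elim w)
        have "G' w = f0 w * E' w" by (simp add: G'_def E'_def)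
        then have "f z * (E' w * cauchy_kernel z w) - G' w * cauchy_kernel z w = E' w * ((f z - f0 w) * cauchy_kernel z w)"
          by (simp add: algebra_simps)
        also have "\<dots> = \<Phi> z w"
          using elim by (simp add: \<Phi>_def S_def cauchy_kernel_def)
        finally show ?case .
      qed
    qed (unfold \<Phi>_def S_def, measurable)
    finally show ?thesis .
  qed
  have bS: "norm (S z w) \<le> M1" if "z \<in> ?V" "w \<in> ?V" for z w
  proof (cases "z = w")
    case True
    then show ?thesis using M1[of z] that by (auto simp: S_def)
  next
    case False
    have "norm (f z - f w) \<le> M1 * norm (z - w)"
    proof (rule field_differentiable_bound[where S = ?V and f' = "deriv f"])
      fix x assume "x \<in> ?V"
      then have "x \<in> W" by (rule VW)
      then show "(f has_field_derivative deriv f x) (at x within ?V)"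
        using f \<open>open W\<close> by (meson has_field_derivative_at_within holomorphic_derivI)
      show "norm (deriv f x) \<le> M1" using M1[of x] \<open>x \<in> ?V\<close> by auto
    qed (use that in auto)
    moreover have "f0 w = f w" using f0_eq[OF VW] that by blast
    ultimately show ?thesis using False by (simp add: S_def norm_divide pos_divide_le_eq)
  qed
  have "(\<lambda>z. \<integral>w. \<Phi> z w \<partial>lborel) field_differentiable at z0"
  proof (rule field_differentiable_integral_parameter[OF \<open>0 < r\<close>])
    show "\<Phi> z \<in> borel_measurable lborel" for z
      unfolding \<Phi>_def S_def by measurable
    show "(\<lambda>z. \<Phi> z w) holomorphic_on ?V" for w
    proof (cases "w \<in> ?V")
      case True
      then have "f0 w = f w" using f0_eq[OF VW] by blast
      then have "S z w = (if z = w then deriv f w else (f z - f w) / (z - w))" for z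
        by (simp add: S_def)
      moreover have "f holomorphic_on ?V"
        using f W ball_subset_cball holomorphic_on_subset by blast
      ultimately have "(\<lambda>z. S z w) holomorphic_on ?V"
        using pole_lemma_open[of f ?V w] by simp
      then show ?thesis
        unfolding \<Phi>_def by (intro holomorphic_intros one_plus_square_nonzero)
    qed (simp add: \<Phi>_def E'_def)
    show "norm (\<Phi> z w) \<le> B * (M1 * (japanese_bracket z0 + r)) * indicator ?V w" if "z \<in> ?V" for z w
    proof (cases "w \<in> ?V")
      case True
      have "norm ((1 + z * cnj w) / of_real (1 + (norm w)\<^sup>2))
          \<le> japanese_bracket z * japanese_bracket w / (japanese_bracket w)\<^sup>2"
        unfolding norm_divide norm_of_real_one_plus_square
        by (intro divide_right_mono norm_one_plus_mult_cnj_le) simp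
      also have "\<dots> = japanese_bracket z / japanese_bracket w"
        using japanese_bracket_pos[of w] by (simp add: power2_eq_square)
      also have "\<dots> \<le> japanese_bracket z / 1"
        using japanese_bracket_ge_1[of w] japanese_bracket_pos[of z] by (intro divide_left_mono) auto
      also have "\<dots> \<le> japanese_bracket z0 + r"
        using japanese_bracket_add_le[of z0 "z - z0"] that by (auto simp: dist_norm norm_minus_commute)
      finally show ?thesis
        using True that bE' bS B0 \<open>0 \<le> M1\<close> unfolding \<Phi>_def norm_mult by (auto intro!: mult_mono)
    qed (simp add: \<Phi>_def E'_def)
    show "integrable lborel (\<lambda>w. B * (M1 * (japanese_bracket z0 + r)) * indicator ?V w)"
      by (intro integrable_mult_right integrable_real_indicator[OF _ emeasure_lborel_ball_finite]) simp
  qed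
  then show ?thesis
    unfolding eq[symmetric] E'_def G'_def .
qed

text \<open>Near z0 the mean is a Cauchy transform up to a constant, so both terms split into near
  and far parts. The near parts form the commutator just treated; the far parts are differentiable
  at z0, also after multiplication by f.\<close>

lemma square_mean_cauchy_transform_field_differentiable:
  fixes f f0 L :: "complex \<Rightarrow> complex" and e M p :: real
  assumes p: "1 < p" and f: "f holomorphic_on W" and "open W" and "z0 \<in> W" and "0 < e"
    and f0[measurable]: "f0 \<in> borel_measurable borel" and f0_eq: "\<And>w. w \<in> W \<Longrightarrow> f0 w = f w"
    and L[measurable]: "L \<in> borel_measurable borel" and M: "\<And>w. norm (L w) \<le> M"
    and fin: "(\<integral>\<^sup>+w. ennreal (norm (f0 w * square_mean_dbar e L w) powr p) \<partial>lborel) < \<infinity>"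
  shows "(\<lambda>z. square_mean e L z * f z - cauchy_transform (\<lambda>w. f0 w * square_mean_dbar e L w) z)
    field_differentiable at z0"
proof -
  obtain r where r: "0 < r" "cball z0 r \<subseteq> W"
    using \<open>open W\<close> \<open>z0 \<in> W\<close> open_contains_cball by blast
  let ?V = "ball z0 r"
  define G where "G = (\<lambda>w. f0 w * square_mean_dbar e L w)"
  \<comment> \<open>The Cauchy representation is for integrable functions, so \<open>L\<close> is
    truncated. At points of the ball of radius r the mean sees \<open>L\<close> only up to distance
    2 e, hence nothing changes there.\<close>
  define L' where "L' = (\<lambda>w. indicator (ball z0 (r + 2 * e)) w * L w)"
  define E where "E = square_mean_dbar e L'"
  have M0: "0 \<le> M" using M[of 0] norm_ge_zero order_trans by blast
  have L'[measurable]: "L' \<in> borel_measurable borel"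
    unfolding L'_def by (intro borel_measurable_times borel_measurable_indicator L) auto
  have E[measurable]: "E \<in> borel_measurable borel" unfolding E_def by measurable
  have G[measurable]: "G \<in> borel_measurable borel" unfolding G_def by measurable
  have bL': "norm (L' w) \<le> M" for w using M[of w] M0 by (auto simp: L'_def indicator_def)
  have bE: "norm (E w) \<le> M / (pi * e)" for w
    unfolding E_def by (rule norm_square_mean_dbar_le[OF L' bL' \<open>0 < e\<close>])
  have near: "L v = L' v" if "z \<in> ?V" "v \<in> cball z (2 * e)" for z v
    using that dist_triangle[of z0 v z] by (auto simp: L'_def)
  have mean: "square_mean e L z = square_mean e L' z" if "z \<in> ?V" for z
    using near[OF that] \<open>0 < e\<close> by (rule square_mean_cong)
  have dbar: "square_mean_dbar e L z = E z" if "z \<in> ?V" for z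
    unfolding E_def using near[OF that] \<open>0 < e\<close> by (rule square_mean_dbar_cong)
  \<comment> \<open>One 2 e comes from the truncation radius, the other from the reach of the
    contour integral.\<close>
  have supp: "E w = 0" if "w \<notin> ball z0 (r + 4 * e)" for w
  proof -
    have "E w = square_mean_dbar e (\<lambda>_. 0) w"
      unfolding E_def
    proof (rule square_mean_dbar_cong)
      fix v assume "v \<in> cball w (2 * e)"
      then show "L' v = 0"
        using that dist_triangle[of z0 w v] \<open>0 < e\<close> by (auto simp: L'_def dist_commute)
    qed fact
    then show ?thesis by (simp add: square_mean_dbar_const)
  qed
  have intL': "integrable lborel L'"
    by (rule integrable_bounded_ball[OF L' bL', where c = z0 and R = "r + 2 * e"]) (simp add: L'_def)
  have intE: "integrable lborel E"
    by (rule integrable_bounded_ball[OF E bE supp])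
  have finE: "(\<integral>\<^sup>+w. ennreal (norm (E w) powr p) \<partial>lborel) < \<infinity>"
    by (rule nn_integral_powr_bounded_ball[OF E bE supp p])
  define c0 where "c0 = (\<integral>w. E w * (cnj w / of_real (1 + (norm w)\<^sup>2)) \<partial>lborel)"
  have repr: "square_mean e L' z = cauchy_transform E z - c0" for z
    using square_mean_eq_cauchy_integral[OF L' bL' intL' \<open>0 < e\<close>, of z]
      cauchy_transform_bounded_integrable(2)[OF E bE intE, of z] by (simp add: E_def c0_def)
  have "compact (f ` cball z0 r)"
    using r f by (auto intro!: compact_continuous_image intro: holomorphic_on_imp_continuous_on holomorphic_on_subset)
  then obtain Mf where Mf: "\<And>z. z \<in> cball z0 r \<Longrightarrow> norm (f z) \<le> Mf"
    by (metis bounded_iff compact_imp_bounded imageI)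
  have bG: "norm (G w) \<le> Mf * (M / (pi * e))" if "w \<in> ?V" for w
  proof -
    have "norm (f w) \<le> Mf" using Mf[of w] that by auto
    moreover have "w \<in> cball z0 r" using that by auto
    then have "f0 w = f w" using f0_eq[of w] r by blast
    ultimately show ?thesis
      using bE[of w] order_trans[OF norm_ge_zero \<open>norm (f w) \<le> Mf\<close>]
      unfolding G_def dbar[OF that] norm_mult by (intro mult_mono) auto
  qed
  note splitE = cauchy_transform_split[where ?z0.0 = z0, OF p E finE r(1) bE]
  have finG: "(\<integral>\<^sup>+w. ennreal (norm (G w) powr p) \<partial>lborel) < \<infinity>"
    using fin by (simp add: G_def)
  have splitG: "cauchy_transform G z = cauchy_transform (\<lambda>w. indicator ?V w * G w) z
      + cauchy_transform (\<lambda>w. indicator (- ?V) w * G w) z" if "z \<in> ball z0 (r / 2)" for z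
    by (rule cauchy_transform_split(1)[OF p G finG r(1) _ that]) (rule bG)
  have far: "cauchy_transform (\<lambda>w. indicator (- ?V) w * G w) field_differentiable at z0"
    by (rule cauchy_transform_split(2)[OF p G finG r(1)]) (rule bG)
  have fd: "f field_differentiable at z0"
    using f \<open>open W\<close> \<open>z0 \<in> W\<close> holomorphic_on_imp_differentiable_at by blast
  have decomp: "(\<lambda>z. (f z * cauchy_transform (\<lambda>w. indicator ?V w * E w) z
            - cauchy_transform (\<lambda>w. indicator ?V w * (f0 w * E w)) z)
          + ((cauchy_transform (\<lambda>w. indicator (- ?V) w * E w) z - c0) * f z
            - cauchy_transform (\<lambda>w. indicator (- ?V) w * G w) z)) field_differentiable at z0"
    by (rule field_differentiable_add[OF
          cauchy_transform_commutator_field_differentiable[OF f \<open>open W\<close> r(2,1) f0 f0_eq E bE]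
          field_differentiable_diff[OF field_differentiable_mult[OF
            field_differentiable_diff[OF splitE(2) field_differentiable_const] fd] far]])
  have eq: "(f z * cauchy_transform (\<lambda>w. indicator ?V w * E w) z
            - cauchy_transform (\<lambda>w. indicator ?V w * (f0 w * E w)) z)
          + ((cauchy_transform (\<lambda>w. indicator (- ?V) w * E w) z - c0) * f z
            - cauchy_transform (\<lambda>w. indicator (- ?V) w * G w) z)
        = square_mean e L z * f z - cauchy_transform G z" if "dist z z0 < r / 2" for z
  proof -
    have z: "z \<in> ball z0 (r / 2)" "z \<in> ?V" using that r by (auto simp: dist_commute)
    have "(\<lambda>w. indicator ?V w * (f0 w * E w)) = (\<lambda>w. indicator ?V w * G w)"
      using dbar by (auto simp: G_def indicator_def)
    then show ?thesis
      by (simp only: mean[OF z(2)] repr splitE(1)[OF z(1)] splitG[OF z(1)]) (simp add: algebra_simps)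
  qed
  show ?thesis
    unfolding G_def[symmetric]
    by (rule field_differentiable_transform_within[OF half_gt_zero[OF r(1)] UNIV_I _ decomp]) (rule eq)
qed

subsection \<open>The decomposition\<close>

text \<open>Rests on (a + b)^p <= (2 a)^p + (2 b)^p. For the term with \<open>f0\<close> it suffices
  that the weight is at most 1; the term with \<open>u\<close> is handled by
  \<open>Q\<close>.\<close>

lemma bergman_space_omega1I:
  fixes p c :: real and h f0 u :: "complex \<Rightarrow> complex"
  assumes p: "1 < p" and h: "h holomorphic_on \<Omega>" and "0 \<le> c"
    and [measurable]: "f0 \<in> borel_measurable borel"
    and f0: "(\<integral>\<^sup>+w. ennreal (norm (f0 w) powr p) \<partial>lborel) < \<infinity>"
    and [measurable]: "Q \<in> borel_measurable borel" and Q: "(\<integral>\<^sup>+w. Q w \<partial>lborel) < \<infinity>"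
    and u: "\<And>z. ennreal (norm (u z) powr p * omega1 p z) \<le> Q z"
    and le: "\<And>z. z \<in> \<Omega> \<Longrightarrow> norm (h z) \<le> c * norm (f0 z) + norm (u z)"
  shows "h \<in> bergman_space p \<Omega> (omega1 p)"
proof -
  have omega: "0 \<le> omega1 p z" "omega1 p z \<le> 1" for z
  proof -
    have "1 \<le> 1 + norm z powr (2 * p)" by simp
    then show "0 \<le> omega1 p z" "omega1 p z \<le> 1"
      unfolding omega1_def using le_imp_inverse_le[of 1 "1 + norm z powr (2 * p)"] by simp_all
  qed
  have "(\<integral>\<^sup>+z\<in>\<Omega>. ennreal (norm (h z) powr p * omega1 p z) \<partial>lborel)
      \<le> (\<integral>\<^sup>+z. ennreal ((2 * c) powr p) * ennreal (norm (f0 z) powr p) + ennreal (2 powr p) * Q z \<partial>lborel)"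
  proof (rule nn_integral_mono)
    fix z
    show "ennreal (norm (h z) powr p * omega1 p z) * indicator \<Omega> z
        \<le> ennreal ((2 * c) powr p) * ennreal (norm (f0 z) powr p) + ennreal (2 powr p) * Q z"
    proof (cases "z \<in> \<Omega>")
      case True
      have "norm (h z) \<le> 2 * max (c * norm (f0 z)) (norm (u z))"
        using le[OF True] by (auto simp: max_def)
      then have "norm (h z) powr p \<le> (2 * max (c * norm (f0 z)) (norm (u z))) powr p"
        using p by (intro powr_mono2) auto
      also have "\<dots> \<le> (2 * c) powr p * norm (f0 z) powr p + 2 powr p * norm (u z) powr p"
        using \<open>0 \<le> c\<close> by (simp add: max_def powr_mult mult.assoc)
      finally have "norm (h z) powr p * omega1 p z
          \<le> ((2 * c) powr p * norm (f0 z) powr p + 2 powr p * norm (u z) powr p) * omega1 p z"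
        using omega by (intro mult_right_mono) auto
      also have "\<dots> = (2 * c) powr p * norm (f0 z) powr p * omega1 p z + 2 powr p * (norm (u z) powr p * omega1 p z)"
        by (simp add: distrib_right)
      also have "\<dots> \<le> (2 * c) powr p * norm (f0 z) powr p + 2 powr p * (norm (u z) powr p * omega1 p z)"
        using omega[of z] by (intro add_right_mono mult_left_le) auto
      finally have "ennreal (norm (h z) powr p * omega1 p z)
          \<le> ennreal ((2 * c) powr p) * ennreal (norm (f0 z) powr p) + ennreal (2 powr p) * ennreal (norm (u z) powr p * omega1 p z)"
        using omega[of z] by (simp add: ennreal_mult[symmetric] ennreal_plus[symmetric] ennreal_leI del: ennreal_plus)
      also have "\<dots> \<le> ennreal ((2 * c) powr p) * ennreal (norm (f0 z) powr p) + ennreal (2 powr p) * Q z"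
        by (intro add_left_mono mult_left_mono u) auto
      finally show ?thesis using True by simp
    qed simp
  qed
  also have "\<dots> < \<infinity>"
    using f0 Q by (simp add: nn_integral_add nn_integral_cmult ennreal_mult_less_top)
  finally show ?thesis using h by (simp add: bergman_space_def)
qed

lemma esetdist_posE:
  assumes "esetdist A B > 0"
  obtains d where "0 < d" "\<And>a b. a \<in> A \<Longrightarrow> b \<in> B \<Longrightarrow> d \<le> norm (a - b)"
proof -
  \<comment> \<open>A real number strictly below the distance, since the distance is infinite when
    one of the sets is empty.\<close>
  obtain d where d: "0 < ereal d" "ereal d < esetdist A B"
    using assms ereal_dense2 by blast
  show ?thesis
  proof
    show "0 < d" using d by simp
    fix a b assume "a \<in> A" "b \<in> B"
    then have "esetdist A B \<le> ereal (norm (a - b))"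
      unfolding esetdist_def by (intro INF_lower2[of "(a, b)"]) auto
    then show "d \<le> norm (a - b)"
      using d by (meson ereal_less_eq(3) less_imp_le order.trans)
  qed
qed

theorem theorem1p1:
  fixes p :: real and \<Omega>1 \<Omega>2 :: "complex set"
  assumes "1 < p"
    and "open \<Omega>1" and "open \<Omega>2"
    and "\<Omega>1 \<inter> \<Omega>2 \<noteq> {}"
    and "esetdist (\<Omega>1 - \<Omega>2) (\<Omega>2 - \<Omega>1) > 0"
  shows "\<forall>f \<in> bergman_space p (\<Omega>1 \<inter> \<Omega>2) (\<lambda>_. 1).
           \<exists>f1 \<in> bergman_space p \<Omega>1 (omega1 p). \<exists>f2 \<in> bergman_space p \<Omega>2 (omega1 p).
             \<forall>z \<in> \<Omega>1 \<inter> \<Omega>2. f z = f1 z + f2 z"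
proof
  fix f assume "f \<in> bergman_space p (\<Omega>1 \<inter> \<Omega>2) (\<lambda>_. 1)"
  let ?W = "\<Omega>1 \<inter> \<Omega>2"
  have f: "f holomorphic_on ?W"
    and finf: "(\<integral>\<^sup>+z\<in>?W. ennreal (norm (f z) powr p) \<partial>lborel) < \<infinity>"
    using \<open>f \<in> _\<close> by (auto simp: bergman_space_def)
  have "open ?W" using assms by blast
  obtain d where d: "0 < d" "\<And>a b. a \<in> \<Omega>1 - \<Omega>2 \<Longrightarrow> b \<in> \<Omega>2 - \<Omega>1 \<Longrightarrow> d \<le> norm (a - b)"
    using esetdist_posE[OF assms(5)] by blast
  \<comment> \<open>Half of the gap; as a union of balls \<open>N\<close> is open and hence
    measurable.\<close>
  define N where "N = (\<Union>a\<in>\<Omega>1 - \<Omega>2. ball a (d / 2))"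
  \<comment> \<open>The cutoff must be constant within 2 e of either difference set, and averaging
    reaches another 2 e. In total 4 e = d/4, below d/2.\<close>
  define e where "e = d / 16"
  have "0 < e" using d by (simp add: e_def)
  define L :: "complex \<Rightarrow> complex" where "L = indicator N"
  have [measurable]: "N \<in> sets borel" unfolding N_def by (intro borel_open open_UN) auto
  have L[measurable]: "L \<in> borel_measurable borel" unfolding L_def by measurable
  have bL: "norm (L w) \<le> 1" for w by (simp add: L_def indicator_def)
  define cut where "cut = square_mean e L"
  define E where "E = square_mean_dbar e L"
  \<comment> \<open>The values of \<open>f\<close> outside the intersection are arbitrary; the zero
    extension is measurable and in L^p of the whole plane.\<close>
  define f0 where "f0 = (\<lambda>z. indicator ?W z *\<^sub>R f z)"
  define G where "G = (\<lambda>w. f0 w * E w)"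
  define u where "u = cauchy_transform G"
  have f0[measurable]: "f0 \<in> borel_measurable borel"
    unfolding f0_def using f \<open>open ?W\<close>
    by (intro borel_measurable_continuous_on_indicator holomorphic_on_imp_continuous_on) auto
  have E[measurable]: "E \<in> borel_measurable borel" unfolding E_def by measurable
  have G[measurable]: "G \<in> borel_measurable borel" unfolding G_def by measurable
  have bE: "norm (E w) \<le> 1 / (pi * e)" for w
    unfolding E_def by (rule norm_square_mean_dbar_le[OF L bL \<open>0 < e\<close>])
  have bcut: "norm (cut w) \<le> 1" for w
    unfolding cut_def by (rule norm_square_mean_le[OF L bL \<open>0 < e\<close>])
  have f0_eq: "f0 w = f w" if "w \<in> ?W" for w using that by (simp add: f0_def)
  have finf0: "(\<integral>\<^sup>+w. ennreal (norm (f0 w) powr p) \<partial>lborel) < \<infinity>"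
    by (rule order.strict_trans1[OF nn_integral_mono finf]) (auto simp: f0_def indicator_def)
  have finG: "(\<integral>\<^sup>+w. ennreal (norm (G w) powr p) \<partial>lborel) < \<infinity>"
  proof -
    have "(\<integral>\<^sup>+w. ennreal (norm (G w) powr p) \<partial>lborel)
        \<le> (\<integral>\<^sup>+w. ennreal ((1 / (pi * e)) powr p) * ennreal (norm (f0 w) powr p) \<partial>lborel)"
    proof (rule nn_integral_mono)
      fix w
      have "norm (G w) powr p = norm (E w) powr p * norm (f0 w) powr p"
        by (simp add: G_def norm_mult powr_mult mult.commute)
      also have "\<dots> \<le> (1 / (pi * e)) powr p * norm (f0 w) powr p"
        using bE[of w] \<open>1 < p\<close> by (intro mult_right_mono powr_mono2) auto
      finally show "ennreal (norm (G w) powr p) \<le> ennreal ((1 / (pi * e)) powr p) * ennreal (norm (f0 w) powr p)"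
        by (simp add: ennreal_mult[symmetric] ennreal_leI)
    qed
    also have "\<dots> < \<infinity>" using finf0 by (simp add: nn_integral_cmult ennreal_mult_less_top)
    finally show ?thesis .
  qed
  obtain Q where Q: "Q \<in> borel_measurable borel" "(\<integral>\<^sup>+z. Q z \<partial>lborel) < \<infinity>"
      "\<And>z. ennreal (norm (u z) powr p * omega1 p z) \<le> Q z"
    using cauchy_transform_weighted_Lp[OF \<open>1 < p\<close> G finG] unfolding u_def by blast
  have const: "cut z = c \<and> E z = 0" if "\<And>v. v \<in> cball z (2 * e) \<Longrightarrow> L v = c" for z c
    using square_mean_cong[of z e L "\<lambda>_. c"] square_mean_dbar_cong[of z e L "\<lambda>_. c"] that \<open>0 < e\<close>
    by (simp add: cut_def E_def square_mean_const square_mean_dbar_const)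
  have nearA: "cut z = 1 \<and> E z = 0" if "a \<in> \<Omega>1 - \<Omega>2" "dist a z < 2 * e" for a z
  proof (rule const)
    fix v assume "v \<in> cball z (2 * e)"
    then have "dist a v < d / 2"
      using that dist_triangle[of a v z] \<open>0 < e\<close> by (auto simp: e_def)
    then have "v \<in> N" unfolding N_def using that by (intro UN_I[of a]) auto
    then show "L v = 1" by (simp add: L_def)
  qed
  have nearB: "cut z = 0 \<and> E z = 0" if "b \<in> \<Omega>2 - \<Omega>1" "dist b z < 2 * e" for b z
  proof (rule const)
    fix v assume v: "v \<in> cball z (2 * e)"
    have "v \<notin> N"
    proof
      assume "v \<in> N"
      then obtain a where "a \<in> \<Omega>1 - \<Omega>2" "dist a v < d / 2" by (auto simp: N_def)
      moreover from this have "d \<le> dist a b" using d that by (auto simp: dist_norm)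
      ultimately show False
        using v that dist_triangle[of a b v] dist_triangle[of v b z] \<open>0 < e\<close>
        by (auto simp: e_def dist_commute)
    qed
    then show "L v = 0" by (simp add: L_def)
  qed
  \<comment> \<open>The disc of radius 2 e around z0 may meet the intersection, where f0 is
    uncontrolled, but E and hence G vanish on it.\<close>
  have u_outside: "u field_differentiable at z0" if "z0 \<in> (\<Omega>1 - \<Omega>2) \<union> (\<Omega>2 - \<Omega>1)" for z0
    unfolding u_def
  proof (rule cauchy_transform_field_differentiable_far[OF \<open>1 < p\<close> G finG])
    show "G w = 0" if "w \<in> ball z0 (2 * e)" for w
      using \<open>z0 \<in> _\<close> nearA[of z0 w] nearB[of z0 w] that by (auto simp: G_def)
  qed (use \<open>0 < e\<close> in auto)
  have inside: "(\<lambda>z. cut z * f z - u z) field_differentiable at z0" if "z0 \<in> ?W" for z0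
    using square_mean_cauchy_transform_field_differentiable[OF \<open>1 < p\<close> f \<open>open ?W\<close> that \<open>0 < e\<close> f0 f0_eq L bL] finG
    unfolding cut_def E_def G_def u_def by simp
  define f2 where "f2 = (\<lambda>z. cut z * f0 z - u z)"
  define f1 where "f1 = (\<lambda>z. (1 - cut z) * f0 z + u z)"
  have sum: "f1 z + f2 z = f0 z" for z
    by (simp add: f1_def f2_def algebra_simps)
  have f2_inside: "f2 field_differentiable at z0" if z0: "z0 \<in> ?W" for z0
  proof -
    have "f2 field_differentiable (at z0 within ?W)"
      by (rule field_differentiable_transform_within[OF zero_less_one z0 _
            field_differentiable_at_within[OF inside[OF z0]]]) (simp add: f2_def f0_eq)
    then show ?thesis by (simp only: at_within_open[OF z0 \<open>open ?W\<close>])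
  qed
  have f1_inside: "f1 field_differentiable at z0" if z0: "z0 \<in> ?W" for z0
  proof -
    have "f field_differentiable at z0"
      using f \<open>open ?W\<close> z0 holomorphic_on_imp_differentiable_at by blast
    \<comment> \<open>On the intersection f1 + f2 = f, so f1 inherits differentiability from f and
      f2.\<close>
    then have diff: "(\<lambda>z. f z - f2 z) field_differentiable at z0"
      using f2_inside[OF z0] by (rule field_differentiable_diff)
    have eq: "f z - f2 z = f1 z" if "z \<in> ?W" for z
      using sum[of z] f0_eq[OF that] by (metis add_diff_cancel_right')
    have "f1 field_differentiable (at z0 within ?W)"
      by (rule field_differentiable_transform_within[OF zero_less_one z0 _
            field_differentiable_at_within[OF diff]]) (rule eq)
    then show ?thesis by (simp only: at_within_open[OF z0 \<open>open ?W\<close>])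
  qed
  \<comment> \<open>Here cut = 1 near z0, so the factor 1 - cut removes the possibly discontinuous
    f0 and f1 = u. The same happens for f2 with cut = 0.\<close>
  have "f1 field_differentiable at z0" if z0: "z0 \<in> \<Omega>1 - \<Omega>2" for z0
  proof -
    have eq: "u z = f1 z" if "dist z z0 < 2 * e" for z
      using nearA[OF z0, of z] that by (simp add: f1_def dist_commute)
    have pos: "0 < 2 * e" and fd: "u field_differentiable at z0"
      using \<open>0 < e\<close> u_outside z0 by auto
    show ?thesis
      by (rule field_differentiable_transform_within[OF pos UNIV_I _ fd]) (rule eq)
  qed
  then have "f1 field_differentiable at z0" if "z0 \<in> \<Omega>1" for z0
    using f1_inside[of z0] that by blast
  then have h1: "f1 holomorphic_on \<Omega>1"
    unfolding holomorphic_on_def using field_differentiable_at_within by blast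
  have "f2 field_differentiable at z0" if z0: "z0 \<in> \<Omega>2 - \<Omega>1" for z0
  proof -
    have eq: "- u z = f2 z" if "dist z z0 < 2 * e" for z
      using nearB[OF z0, of z] that by (simp add: f2_def dist_commute)
    have pos: "0 < 2 * e" and fd: "(\<lambda>z. - u z) field_differentiable at z0"
      using \<open>0 < e\<close> field_differentiable_minus[OF u_outside] z0 by auto
    show ?thesis
      by (rule field_differentiable_transform_within[OF pos UNIV_I _ fd]) (rule eq)
  qed
  then have "f2 field_differentiable at z0" if "z0 \<in> \<Omega>2" for z0
    using f2_inside[of z0] that by blast
  then have h2: "f2 holomorphic_on \<Omega>2"
    unfolding holomorphic_on_def using field_differentiable_at_within by blast
  have "f1 \<in> bergman_space p \<Omega>1 (omega1 p)"
  proof (rule bergman_space_omega1I[OF \<open>1 < p\<close> h1 _ f0 finf0 Q])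
    fix z
    have "norm (1 - cut z) \<le> 2" using bcut[of z] norm_triangle_ineq4[of 1 "cut z"] by simp
    then have "norm ((1 - cut z) * f0 z) \<le> 2 * norm (f0 z)"
      unfolding norm_mult by (intro mult_right_mono) auto
    then show "norm (f1 z) \<le> 2 * norm (f0 z) + norm (u z)"
      unfolding f1_def by (intro norm_triangle_le) simp
  qed simp
  moreover have "f2 \<in> bergman_space p \<Omega>2 (omega1 p)"
  proof (rule bergman_space_omega1I[OF \<open>1 < p\<close> h2 _ f0 finf0 Q])
    fix z
    have "norm (cut z * f0 z) \<le> 1 * norm (f0 z)"
      unfolding norm_mult using bcut[of z] by (intro mult_right_mono) auto
    then show "norm (f2 z) \<le> 1 * norm (f0 z) + norm (u z)"
      unfolding f2_def using norm_triangle_ineq4[of "cut z * f0 z" "u z"] by simp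
  qed simp
  moreover have "\<forall>z\<in>?W. f z = f1 z + f2 z"
    by (simp add: sum f0_eq)
  ultimately show "\<exists>f1 \<in> bergman_space p \<Omega>1 (omega1 p). \<exists>f2 \<in> bergman_space p \<Omega>2 (omega1 p).
      \<forall>z \<in> \<Omega>1 \<inter> \<Omega>2. f z = f1 z + f2 z"
    by blast
qed

end
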